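(* There is no minimal Lagrangian annulus in $\mathbb{B}^4$ with Legendrian free boundary on $\mathbb{S}^3$; that is, if $A$ is a compact annulus (a surface diffeomorphic to $[0,1]\times S^1$), there is no minimal Lagrangian immersion $x:A\to\mathbb{B}^4$ with Legendrian free boundary on $\mathbb{S}^3$.
   Context: $\mathbb{R}^4=\mathbb{C}^2$ carries its standard Euclidean inner product $\langle\cdot,\cdot\rangle$ and standard orthogonal complex structure $J$. $\mathbb{B}^4$ is the closed unit ball and $\mathbb{S}^3=\partial\mathbb{B}^4$. An immersed surface $x:\Sigma\to\mathbb{B}^4$ is Lagrangian if $J T\Sigma=T^{\bot}\Sigma$ (the normal bundle in $\mathbb{R}^4$), and minimal if its mean curvature vector vanishes. It has Legendrian boundary on $\mathbb{S}^3$ if $x(\partial\Sigma)\subset\mathbb{S}^3$ and the vector $Jx(p)$ is orthogonal to $dx(T_p\partial\Sigma)$ at each $p\in\partial\Sigma$. In that case the unit outward normal $\nu$ of $\partial\Sigma$ in $\Sigma$ (tangent to $\Sigma$) lies in $\mathrm{span}\{x,Jx\}$ and is written $\nu=\sin\theta\, x+\cos\theta\, Jx$ with contact angle $\theta:\partial\Sigma\to[0,\pi)$. The boundary is Legendrian free boundary if $\theta\equiv\frac{\pi}{2}$, i.e. $\nu=x$ along $\partial\Sigma$. *)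

theory Defs
  imports "HOL-Analysis.Analysis"
begin

text \<open>
  \<open>\<real>\<^sup>4 = \<complex>\<^sup>2\<close> is the type \<open>complex ^ 2\<close>; its inner product is the Euclidean (real) one, and
  the closed unit ball and the unit 3-sphere are \<open>cball 0 1\<close> and \<open>sphere 0 1\<close>.
\<close>

definition cplx_J :: "complex ^ 2 \<Rightarrow> complex ^ 2" where
  "cplx_J v = \<i> *s v"

text \<open>
  Differentials are taken within \<open>S\<close>, so that for a convex set \<open>S\<close> with nonempty interior (where
  they are unique) this is smoothness up to the boundary.
\<close>

primrec Ck_on :: "nat \<Rightarrow> 'a::euclidean_space set \<Rightarrow> ('a \<Rightarrow> 'b::real_normed_vector) \<Rightarrow> bool" where
  "Ck_on 0 S f \<longleftrightarrow> continuous_on S f"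
| "Ck_on (Suc k) S f \<longleftrightarrow>
     f differentiable_on S \<and> (\<forall>v. Ck_on k S (\<lambda>p. frechet_derivative f (at p within S) v))"

definition smooth_on :: "'a::euclidean_space set \<Rightarrow> ('a \<Rightarrow> 'b::real_normed_vector) \<Rightarrow> bool" where
  "smooth_on S f \<longleftrightarrow> (\<forall>k. Ck_on k S f)"

definition annulus :: "(real \<times> complex) set" where
  "annulus = {0..1} \<times> sphere 0 1"

definition annulus_boundary :: "(real \<times> complex) set" where
  "annulus_boundary = {0, 1} \<times> sphere 0 1"

text \<open>
  The annulus is given the smooth structure for which the universal covering
  \<open>(s, t) \<mapsto> (s, cis t)\<close> of it by the closed strip is a local diffeomorphism. Smoothness, differentials
  and curvature of a map \<open>x\<close> on the annulus are read off in the coordinates \<open>(s, t)\<close>, that is, from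
  \<open>annulus_lift x\<close>. Every point of the annulus is covered, and the conditions below do not depend on
  the chosen preimage.
\<close>

definition strip :: "(real \<times> real) set" where
  "strip = {0..1} \<times> UNIV"

definition strip_boundary :: "(real \<times> real) set" where
  "strip_boundary = {0, 1} \<times> UNIV"

definition annulus_lift :: "(real \<times> complex \<Rightarrow> 'b) \<Rightarrow> real \<times> real \<Rightarrow> 'b" where
  "annulus_lift x = (\<lambda>(s, t). x (s, cis t))"

definition diff1 :: "(real \<times> real \<Rightarrow> complex ^ 2) \<Rightarrow> real \<times> real \<Rightarrow> real \<times> real \<Rightarrow> complex ^ 2" where
  "diff1 X p v = frechet_derivative X (at p within strip) v"

definition diff2 ::
  "(real \<times> real \<Rightarrow> complex ^ 2) \<Rightarrow> real \<times> real \<Rightarrow> real \<times> real \<Rightarrow> real \<times> real \<Rightarrow> complex ^ 2" where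
  "diff2 X p u v = diff1 (\<lambda>q. diff1 X q v) p u"

definition tangent_plane :: "(real \<times> real \<Rightarrow> complex ^ 2) \<Rightarrow> real \<times> real \<Rightarrow> (complex ^ 2) set" where
  "tangent_plane X p = range (diff1 X p)"

definition normal_part :: "(complex ^ 2) set \<Rightarrow> complex ^ 2 \<Rightarrow> complex ^ 2" where
  "normal_part T v = (THE w. w \<in> orthogonal_comp T \<and> v - w \<in> T)"

definition second_fundamental_form ::
  "(real \<times> real \<Rightarrow> complex ^ 2) \<Rightarrow> real \<times> real \<Rightarrow> real \<times> real \<Rightarrow> real \<times> real \<Rightarrow> complex ^ 2" where
  "second_fundamental_form X p u v = normal_part (tangent_plane X p) (diff2 X p u v)"

text \<open>
  Half the trace of the second fundamental form with respect to the induced metric, whose matrix in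
  the coordinates \<open>(s, t)\<close> has the entries \<open>E\<close>, \<open>F\<close>, \<open>G\<close>.
\<close>

definition mean_curvature_vector ::
  "(real \<times> real \<Rightarrow> complex ^ 2) \<Rightarrow> real \<times> real \<Rightarrow> complex ^ 2" where
  "mean_curvature_vector X p =
    (let e1 = (1, 0); e2 = (0, 1);
         E = diff1 X p e1 \<bullet> diff1 X p e1;
         F = diff1 X p e1 \<bullet> diff1 X p e2;
         G = diff1 X p e2 \<bullet> diff1 X p e2;
         B = second_fundamental_form X p
     in (1 / (2 * (E * G - F\<^sup>2))) *\<^sub>R
          (G *\<^sub>R B e1 e1 - (2 * F) *\<^sub>R B e1 e2 + E *\<^sub>R B e2 e2))"

definition annulus_immersion :: "(real \<times> complex \<Rightarrow> complex ^ 2) \<Rightarrow> bool" where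
  "annulus_immersion x \<longleftrightarrow>
     smooth_on strip (annulus_lift x) \<and> (\<forall>p\<in>strip. inj (diff1 (annulus_lift x) p))"

definition lagrangian :: "(real \<times> complex \<Rightarrow> complex ^ 2) \<Rightarrow> bool" where
  "lagrangian x \<longleftrightarrow>
     (\<forall>p\<in>strip. cplx_J ` tangent_plane (annulus_lift x) p =
                orthogonal_comp (tangent_plane (annulus_lift x) p))"

definition minimal :: "(real \<times> complex \<Rightarrow> complex ^ 2) \<Rightarrow> bool" where
  "minimal x \<longleftrightarrow> (\<forall>p\<in>strip. mean_curvature_vector (annulus_lift x) p = 0)"

definition legendrian_boundary :: "(real \<times> complex \<Rightarrow> complex ^ 2) \<Rightarrow> bool" where
  "legendrian_boundary x \<longleftrightarrow>
     x ` annulus_boundary \<subseteq> sphere 0 1 \<and>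
     (\<forall>p\<in>strip_boundary. \<forall>c. orthogonal (cplx_J (annulus_lift x p)) (diff1 (annulus_lift x) p (0, c)))"

text \<open>
  At a boundary point, a coordinate vector \<open>w\<close> points strictly out of the strip iff
  \<open>fst w > 0\<close> (on the side \<open>s = 1\<close>), respectively \<open>fst w < 0\<close> (on the side \<open>s = 0\<close>).
\<close>

definition outward_conormal :: "(real \<times> real \<Rightarrow> complex ^ 2) \<Rightarrow> real \<times> real \<Rightarrow> complex ^ 2" where
  "outward_conormal X p =
     (THE \<nu>. norm \<nu> = 1 \<and> orthogonal \<nu> (diff1 X p (0, 1)) \<and>
           (\<exists>w. \<nu> = diff1 X p w \<and> (if fst p = 1 then fst w > 0 else fst w < 0)))"

definition has_contact_angle ::
  "(real \<times> real \<Rightarrow> complex ^ 2) \<Rightarrow> real \<times> real \<Rightarrow> real \<Rightarrow> bool" where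
  "has_contact_angle X p \<theta> \<longleftrightarrow>
     0 \<le> \<theta> \<and> \<theta> < pi \<and>
     outward_conormal X p = sin \<theta> *\<^sub>R X p + cos \<theta> *\<^sub>R cplx_J (X p)"

definition legendrian_free_boundary :: "(real \<times> complex \<Rightarrow> complex ^ 2) \<Rightarrow> bool" where
  "legendrian_free_boundary x \<longleftrightarrow>
     legendrian_boundary x \<and>
     (\<forall>p\<in>strip_boundary. has_contact_angle (annulus_lift x) p (pi / 2))"

end

theory Submission
  imports Defs
begin

text \<open>
  A minimal Lagrangian surface is special Lagrangian, so after a hyperkaehler rotation
  \<open>x = (z, w)\<close> is holomorphic for the conformal structure of the surface. Since \<open>x\<close> is the conormal
  on the boundary, the complex tangent line there contains \<open>x\<close>, so the holomorphic 1-form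
  \<open>\<eta> = z dw - w dz\<close> restricts to zero on the boundary. Integrating \<open>\<eta>\<close> from the side \<open>s = 0\<close>
  gives a primitive \<open>g\<close>, and Stokes applied to \<open>cnj g dg\<close> shows \<open>\<eta> = 0\<close>: the
  surface is flat, contained in a complex line. The total turning of \<open>\<partial>x/\<partial>t\<close> along the circles
  \<open>s = const\<close> is then independent of \<open>s\<close>, while the boundary condition makes the turning rates at
  the two ends have opposite signs.
\<close>

subsection \<open>Calculus on the closed strip\<close>

text \<open>The contradiction is Gauss-Bonnet. Along a free boundary the conormal is x itself, so
  the geodesic curvature is 1; on an annulus (Euler characteristic 0) negative total Gauss curvature
  would have to balance it. Minimal surfaces do have K \<le> 0, so the real task is to exclude K <
  0, and this is what \<eta> = 0 achieves. No isothermal coordinates are introduced. That the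
  surface is a complex curve is expressed as dz wedge dw = 0, which says that the tangent plane is a
  complex line and also makes \<eta> closed. The primitive g is single-valued on the annulus because
  it is integrated along the segments t = const only. The Stokes identity has no boundary term since
  \<eta> vanishes along both sides, while cnj \<eta> wedge \<eta> is \<i> times a real 2-form of
  constant sign on a complex curve; hence it vanishes identically. Once \<eta> = 0, x_t behaves like
  a single complex function. Its logarithmic derivative is a closed 1-form, which replaces any
  computation of curvature.\<close>

lemma mem_strip [simp]: "(s, t) \<in> strip \<longleftrightarrow> 0 \<le> s \<and> s \<le> 1"
  by (auto simp: strip_def)

lemma convex_strip: "convex strip"
  unfolding strip_def by (intro convex_Times) auto

lemma has_derivative_unique_strip:
  fixes f :: "real \<times> real \<Rightarrow> 'b::real_normed_vector"
  assumes p: "p \<in> strip"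
    and f: "(f has_derivative f') (at p within strip)" "(f has_derivative f'') (at p within strip)"
  shows "f' = f''"
proof (rule frechet_derivative_unique_within[OF f])
  fix i :: "real \<times> real" and e :: real
  assume i: "i \<in> Basis" and e: "0 < e"
  obtain s t where st: "p = (s, t)" "0 \<le> s" "s \<le> 1"
    using p by (cases p) auto
  \<comment> \<open>A step of length at most 1/2 towards the farther side keeps s + d in [0, 1]; in
    the direction (0, 1) any d stays in the strip.\<close>
  define d where "d = (if s < 1 / 2 then min (e / 2) (1 / 2) else - min (e / 2) (1 / 2))"
  have "0 < \<bar>d\<bar> \<and> \<bar>d\<bar> < e \<and> 0 \<le> s + d \<and> s + d \<le> 1"
    using st e by (auto simp: d_def min_def)
  then show "\<exists>d. 0 < \<bar>d\<bar> \<and> \<bar>d\<bar> < e \<and> p + d *\<^sub>R i \<in> strip"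
    using i st by (intro exI[of _ d]) (auto simp: Basis_prod_def)
qed

lemma frechet_derivative_eq_strip:
  assumes "p \<in> strip" "(f has_derivative f') (at p within strip)"
  shows "frechet_derivative f (at p within strip) = f'"
  using assms has_derivative_unique_strip frechet_derivative_works differentiableI by metis

lemma smooth_on_differentiable_on:
  assumes "smooth_on S f"
  shows "f differentiable_on S"
  using assms[unfolded smooth_on_def, rule_format, of "Suc 0"] by simp

lemma smooth_on_continuous_on:
  assumes "smooth_on S f"
  shows "continuous_on S f"
  using assms[unfolded smooth_on_def, rule_format, of 0] by simp

lemma smooth_on_frechet_derivative:
  assumes "smooth_on S f"
  shows "smooth_on S (\<lambda>p. frechet_derivative f (at p within S) v)"
  unfolding smooth_on_def
proof
  fix k
  show "Ck_on k S (\<lambda>p. frechet_derivative f (at p within S) v)"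
    using assms[unfolded smooth_on_def, rule_format, of "Suc k"] by simp
qed

lemma Ck_on_cong:
  assumes "Ck_on k S f" "\<And>p. p \<in> S \<Longrightarrow> f p = g p"
  shows "Ck_on k S g"
  using assms
proof (induction k arbitrary: f g)
  case 0
  then show ?case using continuous_on_cong by force
next
  case (Suc k)
  have d: "(f has_derivative D) (at p within S) \<longleftrightarrow> (g has_derivative D) (at p within S)"
    if "p \<in> S" for p D
    by (metis Suc.prems(2) has_derivative_transform that)
  have "g differentiable_on S"
    using Suc.prems(1) d unfolding differentiable_on_def differentiable_def Ck_on.simps by meson
  \<comment> \<open>\<open>S\<close> is arbitrary, so derivatives within it may fail to be unique.
    But \<open>frechet_derivative\<close> chooses according to the predicate
    \<open>has_derivative\<close>, and equal predicates give equal choices.\<close>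
  moreover have fd: "frechet_derivative f (at p within S) = frechet_derivative g (at p within S)" if "p \<in> S" for p
    unfolding frechet_derivative_def using d[OF that] by simp
  have "Ck_on k S (\<lambda>p. frechet_derivative g (at p within S) v)" for v
  proof (rule Suc.IH)
    show "Ck_on k S (\<lambda>p. frechet_derivative f (at p within S) v)"
      using Suc.prems(1) by simp
  qed (simp add: fd)
  ultimately show ?case by simp
qed

lemma Ck_on_strip_bounded_linear:
  assumes L: "bounded_linear L" and f: "Ck_on k strip f"
  shows "Ck_on k strip (\<lambda>p. L (f p))"
  using f
proof (induction k arbitrary: f)
  case 0
  then show ?case using bounded_linear.continuous_on[OF L] by simp
next
  case (Suc k)
  have d: "((\<lambda>p. L (f p)) has_derivative (\<lambda>v. L (frechet_derivative f (at p within strip) v))) (at p within strip)"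
    if "p \<in> strip" for p
    by (rule bounded_linear.has_derivative[OF L])
       (use Suc.prems that frechet_derivative_works in \<open>auto simp: differentiable_on_def\<close>)
  then have "(\<lambda>p. L (f p)) differentiable_on strip"
    unfolding differentiable_on_def differentiable_def by blast
  moreover have "Ck_on k strip (\<lambda>p. frechet_derivative (\<lambda>p. L (f p)) (at p within strip) v)" for v
  proof (rule Ck_on_cong)
    show "Ck_on k strip (\<lambda>p. L (frechet_derivative f (at p within strip) v))"
      using Suc.prems by (intro Suc.IH) (simp del: split_paired_All)
    show "L (frechet_derivative f (at p within strip) v) = frechet_derivative (\<lambda>p. L (f p)) (at p within strip) v"
      if "p \<in> strip" for p
      using frechet_derivative_eq_strip[OF that d[OF that]] by simp
  qed
  ultimately show ?case by simp
qed

section \<open>Coordinate derivatives up to the boundary\<close>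

definition partial_s :: "(real \<times> real \<Rightarrow> 'b::real_normed_vector) \<Rightarrow> real \<times> real \<Rightarrow> 'b" where
  "partial_s f p = frechet_derivative f (at p within strip) (1, 0)"

definition partial_t :: "(real \<times> real \<Rightarrow> 'b::real_normed_vector) \<Rightarrow> real \<times> real \<Rightarrow> 'b" where
  "partial_t f p = frechet_derivative f (at p within strip) (0, 1)"

lemma smooth_on_partial_s: "smooth_on strip f \<Longrightarrow> smooth_on strip (partial_s f)"
  using smooth_on_frechet_derivative[of strip f "(1, 0)"] unfolding partial_s_def[abs_def] .

lemma smooth_on_partial_t: "smooth_on strip f \<Longrightarrow> smooth_on strip (partial_t f)"
  using smooth_on_frechet_derivative[of strip f "(0, 1)"] unfolding partial_t_def[abs_def] .

lemma smooth_on_has_derivative: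
  assumes "smooth_on S f" "p \<in> S"
  shows "(f has_derivative frechet_derivative f (at p within S)) (at p within S)"
  using smooth_on_differentiable_on[OF assms(1)] assms(2)
  by (auto simp: differentiable_on_def frechet_derivative_works)

lemma frechet_derivative_strip_eq_partials:
  fixes f :: "real \<times> real \<Rightarrow> 'b::real_normed_vector"
  assumes "smooth_on strip f" "p \<in> strip"
  shows "frechet_derivative f (at p within strip) v = fst v *\<^sub>R partial_s f p + snd v *\<^sub>R partial_t f p"
proof -
  interpret linear "frechet_derivative f (at p within strip)"
    using smooth_on_has_derivative[OF assms] has_derivative_linear by blast
  have "frechet_derivative f (at p within strip) v =
      frechet_derivative f (at p within strip) (fst v *\<^sub>R (1, 0) + snd v *\<^sub>R (0, 1))"
    by simp
  also have "\<dots> = fst v *\<^sub>R partial_s f p + snd v *\<^sub>R partial_t f p"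
    unfolding add scale partial_s_def partial_t_def ..
  finally show ?thesis .
qed

lemma has_derivative_partials:
  fixes f :: "real \<times> real \<Rightarrow> 'b::real_normed_vector"
  assumes "smooth_on strip f" "p \<in> strip"
  shows "(f has_derivative (\<lambda>v. fst v *\<^sub>R partial_s f p + snd v *\<^sub>R partial_t f p)) (at p within strip)"
proof -
  have "frechet_derivative f (at p within strip) = (\<lambda>v. fst v *\<^sub>R partial_s f p + snd v *\<^sub>R partial_t f p)"
    using frechet_derivative_strip_eq_partials[OF assms] by (rule ext)
  then show ?thesis
    using smooth_on_has_derivative[OF assms] by argo
qed

lemma partials_bounded_linear:
  fixes f :: "real \<times> real \<Rightarrow> 'b::real_normed_vector"
  assumes L: "bounded_linear L" and f: "smooth_on strip f" and p: "p \<in> strip"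
  shows "partial_s (\<lambda>p. L (f p)) p = L (partial_s f p)"
    and "partial_t (\<lambda>p. L (f p)) p = L (partial_t f p)"
  using frechet_derivative_eq_strip[OF p bounded_linear.has_derivative[OF L smooth_on_has_derivative[OF f p]]]
  by (simp_all add: partial_s_def partial_t_def)

lemma smooth_on_strip_bounded_linear:
  assumes "bounded_linear L" "smooth_on strip f"
  shows "smooth_on strip (\<lambda>p. L (f p))"
  using assms Ck_on_strip_bounded_linear unfolding smooth_on_def by blast

lemma partial_s_has_vector_derivative:
  fixes f :: "real \<times> real \<Rightarrow> 'b::real_normed_vector"
  assumes "smooth_on strip f" "0 \<le> s" "s \<le> 1"
  shows "((\<lambda>s. f (s, t)) has_vector_derivative partial_s f (s, t)) (at s within {0..1})"
proof -
  have "((\<lambda>s. f (s, t)) has_derivative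
     (\<lambda>h. (\<lambda>v. fst v *\<^sub>R partial_s f (s, t) + snd v *\<^sub>R partial_t f (s, t)) (h, 0))) (at s within {0..1})"
    by (rule has_derivative_in_compose2[where t = strip and g = f and f = "\<lambda>s. (s, t)"])
       (use assms in \<open>auto intro!: has_derivative_partials derivative_eq_intros simp del: fst_conv snd_conv\<close>)
  then show ?thesis by (simp add: has_vector_derivative_def)
qed

lemma partial_t_has_vector_derivative:
  fixes f :: "real \<times> real \<Rightarrow> 'b::real_normed_vector"
  assumes "smooth_on strip f" "0 \<le> s" "s \<le> 1"
  shows "((\<lambda>t. f (s, t)) has_vector_derivative partial_t f (s, t)) (at t within T)"
proof -
  have "((\<lambda>t. f (s, t)) has_derivative
     (\<lambda>h. (\<lambda>v. fst v *\<^sub>R partial_s f (s, t) + snd v *\<^sub>R partial_t f (s, t)) (0, h))) (at t)"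
    by (rule has_derivative_in_compose2[where t = strip and g = f and f = "\<lambda>t. (s, t)"])
       (use assms in \<open>auto intro!: has_derivative_partials derivative_eq_intros simp del: fst_conv snd_conv\<close>)
  then show ?thesis by (auto simp add: has_vector_derivative_def intro: has_derivative_at_withinI)
qed

lemma smooth_on_strip_compose_continuous [continuous_intros]:
  assumes "smooth_on strip f" "continuous_on T g" "continuous_on T h"
    "\<And>x. x \<in> T \<Longrightarrow> 0 \<le> g x \<and> g x \<le> 1"
  shows "continuous_on T (\<lambda>x. f (g x, h x))"
  by (rule continuous_on_compose2[OF smooth_on_continuous_on[OF assms(1)]])
     (use assms in \<open>auto intro!: continuous_intros\<close>)

lemma has_vector_derivative_unique_unit_interval:
  assumes "0 \<le> s" "s \<le> 1" "(f has_vector_derivative a) (at s within {0..1::real})"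
    "(f has_vector_derivative b) (at s within {0..1})"
  shows "a = b"
  using vector_derivative_unique_within_closed_interval[of 0 1 s f a b] assms by auto

lemma has_vector_derivative_eqI_unit_interval:
  assumes "0 \<le> s" "s \<le> 1" "(f has_vector_derivative a) (at s within {0..1::real})"
    "(g has_vector_derivative b) (at s within {0..1})" "\<And>u. 0 \<le> u \<Longrightarrow> u \<le> 1 \<Longrightarrow> f u = g u"
  shows "a = b"
proof (rule has_vector_derivative_unique_unit_interval[OF assms(1,2,3)])
  show "(f has_vector_derivative b) (at s within {0..1})"
    by (rule has_vector_derivative_transform[OF _ _ assms(4)]) (use assms in auto)
qed

lemma has_vector_derivative_eqI:
  fixes t :: real
  assumes "(f has_vector_derivative a) (at t)" "(g has_vector_derivative b) (at t)" "\<And>u. f u = g u"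
  shows "a = b"
proof -
  have "f = g" using assms(3) by (rule ext)
  then show ?thesis using assms vector_derivative_unique_at by blast
qed

text \<open>Write f (\<sigma>, u) - f (\<sigma>, a) as an integral of \<open>partial_t f\<close>,
  differentiate under the integral sign in \<sigma>, then in u. This also reaches the sides s = 0
  and s = 1, where only derivatives within the strip are available.\<close>

lemma partial_commute:
  fixes f :: "real \<times> real \<Rightarrow> 'b::banach"
  assumes f: "smooth_on strip f" and s: "0 \<le> s" "s \<le> 1"
  shows "partial_s (partial_t f) (s, t) = partial_t (partial_s f) (s, t)"
proof -
  \<comment> \<open>Starting the interval before t makes t an interior point of {a..t + 1}, so the
    derivative in u is two-sided there.\<close>
  define a where "a = t - 1"
  note sm = f smooth_on_partial_s[OF f] smooth_on_partial_t[OF f]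
    smooth_on_partial_s[OF smooth_on_partial_t[OF f]]
  have I: "integral {a..u} (\<lambda>\<tau>. partial_t f (\<sigma>, \<tau>)) = f (\<sigma>, u) - f (\<sigma>, a)"
    if "0 \<le> \<sigma>" "\<sigma> \<le> 1" "a \<le> u" for \<sigma> u
    by (rule integral_unique[OF fundamental_theorem_of_calculus])
       (use that sm in \<open>auto intro!: partial_t_has_vector_derivative\<close>)
  have J: "integral {a..u} (\<lambda>\<tau>. partial_s (partial_t f) (s, \<tau>)) = partial_s f (s, u) - partial_s f (s, a)"
    if "a \<le> u" for u
  proof (rule has_vector_derivative_eqI_unit_interval[OF s])
    show "((\<lambda>\<sigma>. integral (cbox a u) (\<lambda>\<tau>. partial_t f (\<sigma>, \<tau>))) has_vector_derivative
        integral {a..u} (\<lambda>\<tau>. partial_s (partial_t f) (s, \<tau>))) (at s within {0..1})"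
      unfolding cbox_interval[symmetric, of a u]
    proof (rule leibniz_rule_vector_derivative)
      show "(\<lambda>\<tau>. partial_t f (\<sigma>, \<tau>)) integrable_on cbox a u" if "\<sigma> \<in> {0..1}" for \<sigma>
        by (intro integrable_continuous smooth_on_strip_compose_continuous sm continuous_intros) (use that in auto)
      show "continuous_on ({0..1} \<times> cbox a u) (\<lambda>(\<sigma>, \<tau>). partial_s (partial_t f) (\<sigma>, \<tau>))"
        unfolding split_beta by (intro smooth_on_strip_compose_continuous sm continuous_intros) auto
    qed (use s in \<open>auto intro!: partial_s_has_vector_derivative sm\<close>)
    show "((\<lambda>\<sigma>. f (\<sigma>, u) - f (\<sigma>, a)) has_vector_derivative partial_s f (s, u) - partial_s f (s, a)) (at s within {0..1})"
      by (intro has_vector_derivative_diff partial_s_has_vector_derivative sm s)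
  qed (use I that in auto)
  have at: "at t within {a..t + 1} = at t"
    by (rule at_within_interior) (auto simp: a_def)
  have "((\<lambda>u. integral {a..u} (\<lambda>\<tau>. partial_s (partial_t f) (s, \<tau>))) has_vector_derivative
      partial_s (partial_t f) (s, t)) (at t within {a..t + 1})"
    by (rule integral_has_vector_derivative)
       (use sm s in \<open>auto intro!: continuous_intros simp: a_def\<close>)
  moreover have "((\<lambda>u. integral {a..u} (\<lambda>\<tau>. partial_s (partial_t f) (s, \<tau>))) has_vector_derivative
      partial_t (partial_s f) (s, t)) (at t within {a..t + 1})"
    by (rule has_vector_derivative_transform[where f = "\<lambda>u. partial_s f (s, u) - partial_s f (s, a)"])
       (use s J in \<open>auto intro!: derivative_eq_intros partial_t_has_vector_derivative sm simp: a_def\<close>)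
  ultimately show ?thesis
    unfolding at by (rule vector_derivative_unique_at)
qed

lemma partials_periodic:
  fixes f :: "real \<times> real \<Rightarrow> 'b::real_normed_vector"
  assumes f: "smooth_on strip f" and s: "0 \<le> s" "s \<le> 1"
    and per: "\<And>s t. 0 \<le> s \<Longrightarrow> s \<le> 1 \<Longrightarrow> f (s, t + c) = f (s, t)"
  shows "partial_s f (s, t + c) = partial_s f (s, t)" "partial_t f (s, t + c) = partial_t f (s, t)"
proof -
  show "partial_s f (s, t + c) = partial_s f (s, t)"
    by (rule has_vector_derivative_eqI_unit_interval[OF s]; (assumption | rule partial_s_has_vector_derivative f s per)+)
  have "((\<lambda>t. f (s, t + c)) has_vector_derivative 1 *\<^sub>R partial_t f (s, t + c)) (at t)"
    by (rule vector_diff_chain_at[of "\<lambda>t. t + c" 1 t "\<lambda>t. f (s, t)", unfolded o_def])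
       (auto intro!: derivative_eq_intros partial_t_has_vector_derivative f s)
  then show "partial_t f (s, t + c) = partial_t f (s, t)"
    using has_vector_derivative_eqI[OF _ partial_t_has_vector_derivative[OF f s] per[OF s]] by simp
qed

text \<open>Moves a variable endpoint into the integrand. Joint continuity of \<open>prim\<close>
  then follows from continuity of parameter integrals over a fixed interval.\<close>

lemma integral_rescale:
  fixes f :: "real \<Rightarrow> 'b::euclidean_space"
  assumes f: "continuous_on {0..s} f" and s: "0 \<le> s"
  shows "integral {0..s} f = s *\<^sub>R integral {0..1} (\<lambda>u. f (s * u))"
proof -
  define F where "F = (\<lambda>u. integral {0..u} f)"
  have "((\<lambda>u. s *\<^sub>R f (s * u)) has_integral F (s * 1) - F (s * 0)) {0..1}"
  proof (rule fundamental_theorem_of_calculus)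
    fix u :: real assume u: "u \<in> {0..1}"
    have img: "(*) s ` {0..1} \<subseteq> {0..s}"
      using s by (auto simp: mult_left_le)
    have su: "s * u \<in> {0..s}" using u img by blast
    have "(F has_vector_derivative f (s * u)) (at (s * u) within (*) s ` {0..1})"
      using integral_has_vector_derivative[OF f su] img
      unfolding F_def by (rule has_vector_derivative_within_subset)
    moreover have "((*) s has_vector_derivative s) (at u within {0..1})"
      by (auto intro!: derivative_eq_intros)
    ultimately show "((\<lambda>u. F (s * u)) has_vector_derivative s *\<^sub>R f (s * u)) (at u within {0..1})"
      using vector_diff_chain_within by (fastforce simp: o_def)
  qed simp
  then have "((\<lambda>u. s *\<^sub>R f (s * u)) has_integral integral {0..s} f) {0..1}"
    by (simp add: F_def)
  from integral_unique[OF this] show ?thesis by (simp only: integral_cmul)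
qed

lemma integral_eq_0_imp_eq_0:
  fixes f :: "real \<Rightarrow> real"
  assumes "a < b" "continuous_on {a..b} f" "integral {a..b} f = 0"
    "\<And>x. x \<in> {a..b} \<Longrightarrow> 0 \<le> f x" "x \<in> {a..b}"
  shows "f x = 0"
  using has_integral_0_cbox_imp_0[of a b f x] assms integrable_continuous_interval[of a b f]
  by (auto simp: has_integral_integral)

lemma has_vector_derivative_quotient:
  fixes f g :: "real \<Rightarrow> complex"
  assumes "(f has_vector_derivative f') (at x within T)" "(g has_vector_derivative g') (at x within T)" "g x \<noteq> 0"
  shows "((\<lambda>x. f x / g x) has_vector_derivative f' / g x - f x * g' / (g x)\<^sup>2) (at x within T)"
proof -
  have "((\<lambda>x. f x / g x) has_derivative (\<lambda>h. - f x * (inverse (g x) * (h *\<^sub>R g') * inverse (g x)) + (h *\<^sub>R f') / g x)) (at x within T)"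
    using assms unfolding has_vector_derivative_def by (intro has_derivative_divide)
  moreover have "(\<lambda>h. - f x * (inverse (g x) * (h *\<^sub>R g') * inverse (g x)) + (h *\<^sub>R f') / g x)
      = (\<lambda>h. h *\<^sub>R (f' / g x - f x * g' / (g x)\<^sup>2))"
    using assms(3) by (auto simp: field_simps power2_eq_square scaleR_conv_of_real)
  ultimately show ?thesis unfolding has_vector_derivative_def by simp
qed

subsection \<open>Holomorphic annuli with free boundary\<close>

text \<open>What remains of the problem after the rotation, in arbitrary coordinates.
  \<open>holomorphic\<close> is dz wedge dw = 0; on a plane inside a complex line, the quantity in
  \<open>immersed\<close> is the signed area spanned by x_s and x_t.
  \<open>boundary_conormal\<close> says that x is tangent and points outward, the sign of a being
  that of its s-component.\<close>

locale holomorphic_annulus =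
  fixes z w :: "real \<times> real \<Rightarrow> complex"
  assumes smooth: "smooth_on strip z" "smooth_on strip w"
    and periodic: "z (s, t + 2 * pi) = z (s, t)" "w (s, t + 2 * pi) = w (s, t)"
    and holomorphic: "p \<in> strip \<Longrightarrow> partial_s z p * partial_t w p = partial_t z p * partial_s w p"
    and immersed: "p \<in> strip \<Longrightarrow>
      Im (cnj (partial_s z p) * partial_t z p + cnj (partial_s w p) * partial_t w p) \<noteq> 0"
    and boundary_sphere: "s = 0 \<or> s = 1 \<Longrightarrow> cnj (z (s, t)) * z (s, t) + cnj (w (s, t)) * w (s, t) = 1"
    and boundary_conormal: "s = 0 \<or> s = 1 \<Longrightarrow> \<exists>a b :: real. (if s = 1 then a > 0 else a < 0) \<and>
      z (s, t) = of_real a * partial_s z (s, t) + of_real b * partial_t z (s, t) \<and>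
      w (s, t) = of_real a * partial_s w (s, t) + of_real b * partial_t w (s, t)"
begin

abbreviation "zs \<equiv> partial_s z"
abbreviation "zt \<equiv> partial_t z"
abbreviation "ws \<equiv> partial_s w"
abbreviation "wt \<equiv> partial_t w"
abbreviation "zts \<equiv> partial_s zt"
abbreviation "ztt \<equiv> partial_t zt"
abbreviation "wts \<equiv> partial_s wt"
abbreviation "wtt \<equiv> partial_t wt"

lemmas smooth_partials = smooth smooth_on_partial_s[OF smooth(1)] smooth_on_partial_s[OF smooth(2)]
  smooth_on_partial_t[OF smooth(1)] smooth_on_partial_t[OF smooth(2)]

lemmas smooth_partials2 = smooth_partials
  smooth_partials(5)[THEN smooth_on_partial_s] smooth_partials(5)[THEN smooth_on_partial_t]
  smooth_partials(6)[THEN smooth_on_partial_s] smooth_partials(6)[THEN smooth_on_partial_t]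

lemmas smooth_partials3 = smooth_partials2
  smooth_partials2(7)[THEN smooth_on_partial_t] smooth_partials2(8)[THEN smooth_on_partial_s]
  smooth_partials2(8)[THEN smooth_on_partial_t]
  smooth_partials2(9)[THEN smooth_on_partial_t] smooth_partials2(10)[THEN smooth_on_partial_s]
  smooth_partials2(10)[THEN smooth_on_partial_t]

lemmas der = partial_s_has_vector_derivative partial_t_has_vector_derivative has_vector_derivative_cnj

lemma partials_periodic_zw:
  assumes "0 \<le> s" "s \<le> 1"
  shows "zs (s, t + 2 * pi) = zs (s, t)" "zt (s, t + 2 * pi) = zt (s, t)"
    "ws (s, t + 2 * pi) = ws (s, t)" "wt (s, t + 2 * pi) = wt (s, t)"
  by (assumption | rule partials_periodic smooth assms periodic)+

definition area :: "real \<times> real \<Rightarrow> real" where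
  "area p = Im (cnj (zs p) * zt p + cnj (ws p) * wt p)"

text \<open>The orientation of the complex structure relative to (s, t) is not prescribed. A
  continuous nowhere zero function on the connected strip has a fixed sign, carried later by a
  factor \<epsilon>.\<close>

lemma area_sign: "(\<forall>p\<in>strip. 0 < area p) \<or> (\<forall>p\<in>strip. area p < 0)"
proof (rule ccontr)
  assume "\<not> ?thesis"
  then obtain p q where pq: "p \<in> strip" "q \<in> strip" "area p \<le> 0" "0 \<le> area q"
    by (meson linorder_not_less)
  have "continuous_on strip (\<lambda>p. area (fst p, snd p))"
    unfolding area_def
    by (intro continuous_intros smooth_on_strip_compose_continuous smooth_partials) auto
  then have "connected (area ` strip)"
    by (intro connected_continuous_image convex_connected convex_strip) simp
  then have "0 \<in> area ` strip"
    using pq connected_contains_Icc[of "area ` strip" "area p" "area q"] by auto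
  then show False using immersed by (auto simp: area_def)
qed

section \<open>The 1-form \<eta> and the Stokes argument\<close>

definition wedge_s :: "real \<times> real \<Rightarrow> complex" where
  "wedge_s p = z p * ws p - w p * zs p"

definition wedge_t :: "real \<times> real \<Rightarrow> complex" where
  "wedge_t p = z p * wt p - w p * zt p"

text \<open>The common value of the t-derivative of \<open>wedge_s\<close> and the s-derivative of
  \<open>wedge_t\<close>; they agree because d\<eta> = 2 dz wedge dw = 0.\<close>

definition wedge_st :: "real \<times> real \<Rightarrow> complex" where
  "wedge_st p = z p * wts p - w p * zts p"

lemma wedge_s_t:
  assumes s: "0 \<le> s" "s \<le> 1"
  shows "((\<lambda>t. wedge_s (s, t)) has_vector_derivative wedge_st (s, t)) (at t within T)"
proof -
  have "((\<lambda>t. wedge_s (s, t)) has_vector_derivative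
      (z (s, t) * partial_t ws (s, t) + zt (s, t) * ws (s, t)) -
      (w (s, t) * partial_t zs (s, t) + wt (s, t) * zs (s, t))) (at t within T)"
    unfolding wedge_s_def by (intro derivative_intros der smooth_partials s)
  then show ?thesis
    using partial_commute[OF smooth(1) s] partial_commute[OF smooth(2) s] holomorphic[of "(s, t)"] s
    by (simp add: wedge_st_def algebra_simps)
qed

lemma wedge_t_s:
  assumes s: "0 \<le> s" "s \<le> 1"
  shows "((\<lambda>s. wedge_t (s, t)) has_vector_derivative wedge_st (s, t)) (at s within {0..1})"
proof -
  have "((\<lambda>s. wedge_t (s, t)) has_vector_derivative
      (z (s, t) * wts (s, t) + zs (s, t) * wt (s, t)) -
      (w (s, t) * zts (s, t) + ws (s, t) * zt (s, t))) (at s within {0..1})"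
    unfolding wedge_t_def by (intro derivative_intros der smooth_partials s)
  then show ?thesis
    using holomorphic[of "(s, t)"] s by (simp add: wedge_st_def algebra_simps)
qed

text \<open>Along the boundary x is a tangent vector, so \<eta> applied to x_t is dz wedge dw
  applied to two tangent vectors.\<close>

lemma wedge_t_boundary: "s = 0 \<or> s = 1 \<Longrightarrow> wedge_t (s, t) = 0"
proof -
  assume s: "s = 0 \<or> s = 1"
  then obtain a b :: real where "z (s, t) = of_real a * zs (s, t) + of_real b * zt (s, t)"
    "w (s, t) = of_real a * ws (s, t) + of_real b * wt (s, t)"
    using boundary_conormal by metis
  then have "wedge_t (s, t) = of_real a * (zs (s, t) * wt (s, t) - zt (s, t) * ws (s, t))"
    by (simp add: wedge_t_def algebra_simps)
  then show ?thesis using holomorphic[of "(s, t)"] s by auto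
qed

lemma wedge_continuous:
  assumes "continuous_on T g" "continuous_on T h" "\<And>x. x \<in> T \<Longrightarrow> 0 \<le> g x \<and> g x \<le> 1"
  shows "continuous_on T (\<lambda>x. wedge_s (g x, h x))" "continuous_on T (\<lambda>x. wedge_t (g x, h x))"
    "continuous_on T (\<lambda>x. wedge_st (g x, h x))"
  unfolding wedge_s_def wedge_t_def wedge_st_def
  by (intro continuous_intros smooth_on_strip_compose_continuous smooth_partials2 assms; simp)+

text \<open>Integrating in s alone lets g inherit the period of \<open>wedge_s\<close>. It is a
  primitive in the t-direction as well because \<open>wedge_t\<close> vanishes on the side s =
  0.\<close>

definition prim :: "real \<Rightarrow> real \<Rightarrow> complex" where
  "prim s t = integral {0..s} (\<lambda>\<sigma>. wedge_s (\<sigma>, t))"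

lemma prim_s:
  assumes "0 \<le> s" "s \<le> 1"
  shows "((\<lambda>s. prim s t) has_vector_derivative wedge_s (s, t)) (at s within {0..1})"
  unfolding prim_def
  by (rule integral_has_vector_derivative) (use assms in \<open>auto intro!: wedge_continuous continuous_intros\<close>)

lemma prim_t:
  assumes s: "0 \<le> s" "s \<le> 1"
  shows "((\<lambda>t. prim s t) has_vector_derivative wedge_t (s, t)) (at t)"
proof -
  have "((\<lambda>t. integral (cbox 0 s) (\<lambda>\<sigma>. wedge_s (\<sigma>, t))) has_vector_derivative
      integral (cbox 0 s) (\<lambda>\<sigma>. wedge_st (\<sigma>, t))) (at t within UNIV)"
  proof (rule leibniz_rule_vector_derivative)
    show "(\<lambda>\<sigma>. wedge_s (\<sigma>, u)) integrable_on cbox 0 s" for u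
      by (intro integrable_continuous wedge_continuous continuous_intros) (use s in auto)
    show "continuous_on (UNIV \<times> cbox 0 s) (\<lambda>(u, \<sigma>). wedge_st (\<sigma>, u))"
      unfolding split_beta by (intro wedge_continuous continuous_intros) (use s in auto)
  qed (use s in \<open>auto intro!: wedge_s_t\<close>)
  moreover have "((\<lambda>\<sigma>. wedge_st (\<sigma>, t)) has_integral wedge_t (s, t) - wedge_t (0, t)) {0..s}"
    by (rule fundamental_theorem_of_calculus)
       (use s in \<open>auto intro!: has_vector_derivative_within_subset[OF wedge_t_s]\<close>)
  ultimately show ?thesis
    using wedge_t_boundary[of 0 t] by (simp add: prim_def[abs_def] integral_unique)
qed

lemma prim_continuous: "continuous_on ({0..1} \<times> T) (\<lambda>p. prim (fst p) (snd p))"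
proof -
  have "continuous_on ({0..1} \<times> T)
      (\<lambda>p. fst p *\<^sub>R integral (cbox 0 1) (\<lambda>u. wedge_s (fst p * u, snd p)))"
    by (intro continuous_intros integral_continuous_on_param)
       (auto simp: split_beta intro!: continuous_intros wedge_continuous mult_le_one)
  then show ?thesis
    by (rule continuous_on_eq)
       (auto simp: prim_def intro!: integral_rescale[symmetric] wedge_continuous continuous_intros)
qed

text \<open>\<Phi> is the integral of cnj g dg over the circle s = const. It vanishes for s = 0 and
  s = 1, and its derivative is 2 \<i> times the integral of \<phi>, a function with the sign of
  \<open>area\<close>. So Im \<Phi> is monotone with equal end values, hence \<phi> = 0, and \<phi>
  controls the modulus of \<open>wedge_s\<close>.\<close>

lemma wedge_s_eq_0:
  assumes s: "0 \<le> s" "s \<le> 1"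
  shows "wedge_s (s, t) = 0"
proof -
  \<comment> \<open>The period starts at the given t, so that this point lies in the interval of
    integration.\<close>
  define b where "b = t + 2 * pi"
  define \<Phi> where "\<Phi> = (\<lambda>s. integral (cbox t b) (\<lambda>t. cnj (prim s t) * wedge_t (s, t)))"
  define \<phi> where "\<phi> = (\<lambda>s t. Im (cnj (wedge_s (s, t)) * wedge_t (s, t)))"
  have tb: "t < b" by (simp add: b_def)
  have prim_cont: "continuous_on U (\<lambda>u. prim s u)" if "0 \<le> s" "s \<le> 1" for s U
    by (rule continuous_on_compose2[OF prim_continuous[of UNIV], of _ "\<lambda>u. (s, u)", unfolded fst_conv snd_conv])
       (use that in \<open>auto intro!: continuous_intros\<close>)
  have \<Phi>': "(\<Phi> has_vector_derivative 2 * \<i> * of_real (integral {t..b} (\<phi> s))) (at s within {0..1})"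
    if s: "0 \<le> s" "s \<le> 1" for s
  proof -
    have d: "(\<Phi> has_vector_derivative integral (cbox t b)
        (\<lambda>t. cnj (prim s t) * wedge_st (s, t) + cnj (wedge_s (s, t)) * wedge_t (s, t))) (at s within {0..1})"
      unfolding \<Phi>_def
    proof (rule leibniz_rule_vector_derivative)
      show "(\<lambda>t. cnj (prim s t) * wedge_t (s, t)) integrable_on cbox t b" if "s \<in> {0..1}" for s
        by (intro integrable_continuous wedge_continuous continuous_intros prim_cont) (use that in auto)
      show "continuous_on ({0..1} \<times> cbox t b)
          (\<lambda>(s, t). cnj (prim s t) * wedge_st (s, t) + cnj (wedge_s (s, t)) * wedge_t (s, t))"
        unfolding split_beta by (intro continuous_intros prim_continuous wedge_continuous) auto
    qed (use s in \<open>auto intro!: derivative_intros der prim_s wedge_t_s\<close>)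
    have per: "prim s b = prim s t" "wedge_s (s, b) = wedge_s (s, t)"
      using s periodic partials_periodic_zw
      by (auto simp: prim_def wedge_s_def b_def intro!: integral_cong)
    \<comment> \<open>Integration by parts over a full period: the integrand is the t-derivative of
      cnj g times \<open>wedge_s\<close>, which is periodic.\<close>
    have "((\<lambda>t. cnj (prim s t) * wedge_st (s, t) + cnj (wedge_t (s, t)) * wedge_s (s, t)) has_integral
        cnj (prim s b) * wedge_s (s, b) - cnj (prim s t) * wedge_s (s, t)) {t..b}"
      by (rule fundamental_theorem_of_calculus)
         (use s tb in \<open>auto intro!: derivative_intros der wedge_s_t has_vector_derivative_at_within[OF prim_t]\<close>)
    then have i1: "((\<lambda>t. cnj (prim s t) * wedge_st (s, t) + cnj (wedge_t (s, t)) * wedge_s (s, t)) has_integral 0) {t..b}"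
      using per by simp
    have "(\<lambda>u. \<phi> s u) integrable_on {t..b}"
      unfolding \<phi>_def by (intro integrable_continuous_interval continuous_intros wedge_continuous) (use s in auto)
    then have "((\<lambda>u. of_real (\<phi> s u)) has_integral complex_of_real (integral {t..b} (\<phi> s))) {t..b}"
      by (intro has_integral_of_real) (simp add: has_integral_integral)
    then have i2: "((\<lambda>u. 2 * \<i> * of_real (\<phi> s u)) has_integral 2 * \<i> * of_real (integral {t..b} (\<phi> s))) {t..b}"
      by (rule has_integral_mult_right)
    \<comment> \<open>The difference from the previous integrand is a number minus its conjugate,
      hence 2 \<i> times the imaginary part \<phi>.\<close>
    have "((\<lambda>t. cnj (prim s t) * wedge_st (s, t) + cnj (wedge_s (s, t)) * wedge_t (s, t)) has_integral
        0 + 2 * \<i> * of_real (integral {t..b} (\<phi> s))) {t..b}"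
      by (rule has_integral_eq[OF _ has_integral_add[OF i1 i2]])
         (auto simp: \<phi>_def complex_eq_iff algebra_simps)
    with d show ?thesis by (simp add: integral_unique)
  qed
  \<comment> \<open>The tangent plane is a complex line, so x_t = \<lambda> x_s and therefore
    \<open>wedge_t\<close> = \<lambda> \<open>wedge_s\<close>, where \<lambda> is the hermitian
    product of x_s and x_t divided by the squared norm of x_s. The identity is this with the
    denominator cleared; its imaginary part relates \<phi> to \<open>area\<close>.\<close>
  have key: "(cnj (zs p) * zs p + cnj (ws p) * ws p) * (cnj (wedge_s p) * wedge_t p)
      = (cnj (zs p) * zt p + cnj (ws p) * wt p) * (cnj (wedge_s p) * wedge_s p)" if "p \<in> strip" for p
  proof -
    have "(cnj (zs p) * zs p + cnj (ws p) * ws p) * wedge_t p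
        = (cnj (zs p) * zt p + cnj (ws p) * wt p) * wedge_s p"
      using holomorphic[OF that] unfolding wedge_s_def wedge_t_def by algebra
    then show ?thesis by algebra
  qed
  have Im_mult_real: "Im (of_real r * u) = r * Im u" and Im_mult_real': "Im (u * of_real r) = Im u * r"
    for r :: real and u :: complex by simp_all
  have \<phi>_area: "((cmod (zs (s, t)))\<^sup>2 + (cmod (ws (s, t)))\<^sup>2) * \<phi> s t = area (s, t) * (cmod (wedge_s (s, t)))\<^sup>2"
    if "0 \<le> s" "s \<le> 1" for s t
  proof -
    have "of_real ((cmod (zs (s, t)))\<^sup>2 + (cmod (ws (s, t)))\<^sup>2) * (cnj (wedge_s (s, t)) * wedge_t (s, t))
      = (cnj (zs (s, t)) * zt (s, t) + cnj (ws (s, t)) * wt (s, t)) * of_real ((cmod (wedge_s (s, t)))\<^sup>2)"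
      using key[of "(s, t)"] that by (simp only: of_real_add complex_norm_square mult.commute[of _ "cnj _"] mem_strip)
    from arg_cong[OF this, of Im] show ?thesis
      unfolding \<phi>_def area_def
      by (simp only: Im_mult_real Im_mult_real')
  qed
  obtain \<epsilon> :: real where \<epsilon>: "\<And>p. p \<in> strip \<Longrightarrow> 0 < \<epsilon> * area p"
    using area_sign mult_1 mult_minus1 neg_0_less_iff_less by metis
  have E: "0 < (cmod (zs p))\<^sup>2 + (cmod (ws p))\<^sup>2" if "p \<in> strip" for p
    using immersed[OF that] by (auto simp: sum_power2_gt_zero_iff)
  have \<phi>_nonneg: "0 \<le> \<epsilon> * \<phi> s t" if "0 \<le> s" "s \<le> 1" for s t
  proof -
    have "((cmod (zs (s, t)))\<^sup>2 + (cmod (ws (s, t)))\<^sup>2) * (\<epsilon> * \<phi> s t) = (\<epsilon> * area (s, t)) * (cmod (wedge_s (s, t)))\<^sup>2"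
      using \<phi>_area[OF that, of t] by (simp only: mult.left_commute[of _ \<epsilon>] mult.assoc)
    also have "\<dots> \<ge> 0"
      by (rule mult_nonneg_nonneg[OF less_imp_le[OF \<epsilon>]]) (use that in auto)
    finally show ?thesis
      using E[of "(s, t)"] that by (simp add: zero_le_mult_iff)
  qed
  have int_nonneg: "0 \<le> \<epsilon> * (2 * integral {t..b} (\<phi> s))" if "0 \<le> s" "s \<le> 1" for s
  proof -
    have "0 \<le> integral {t..b} (\<lambda>u. \<epsilon> * \<phi> s u)"
      unfolding \<phi>_def
      by (intro integral_nonneg integrable_continuous_interval continuous_intros wedge_continuous)
         (use that \<phi>_nonneg[unfolded \<phi>_def] in auto)
    then show ?thesis by simp
  qed
  \<comment> \<open>With the factor \<epsilon> the function is nondecreasing for either orientation;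
    being 0 at both ends it is constant.\<close>
  define \<psi> where "\<psi> = (\<lambda>s. \<epsilon> * Im (\<Phi> s))"
  have \<psi>': "(\<psi> has_vector_derivative \<epsilon> * (2 * integral {t..b} (\<phi> s))) (at s within {0..1})"
    if "0 \<le> s" "s \<le> 1" for s
    using bounded_linear.has_vector_derivative[OF bounded_linear_Im \<Phi>'[OF that]]
    unfolding \<psi>_def by (auto intro!: derivative_eq_intros)
  have \<psi>0: "\<psi> 0 = 0" and \<psi>1: "\<psi> 1 = 0"
    by (simp_all add: \<psi>_def \<Phi>_def prim_def wedge_t_boundary)
  have "\<psi> s = 0" if s: "0 \<le> s" "s \<le> 1" for s
  proof -
    have "((\<lambda>s. \<epsilon> * (2 * integral {t..b} (\<phi> s))) has_integral \<psi> s - \<psi> 0) {0..s}"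
      by (rule fundamental_theorem_of_calculus)
         (use s in \<open>auto intro!: has_vector_derivative_within_subset[OF \<psi>']\<close>)
    then have "0 \<le> \<psi> s - \<psi> 0"
      by (rule has_integral_nonneg) (use s int_nonneg in auto)
    moreover have "((\<lambda>s. \<epsilon> * (2 * integral {t..b} (\<phi> s))) has_integral \<psi> 1 - \<psi> s) {s..1}"
      by (rule fundamental_theorem_of_calculus)
         (use s in \<open>auto intro!: has_vector_derivative_within_subset[OF \<psi>']\<close>)
    then have "0 \<le> \<psi> 1 - \<psi> s"
      by (rule has_integral_nonneg) (use s int_nonneg in auto)
    ultimately show ?thesis using \<psi>0 \<psi>1 by simp
  qed
  then have "\<epsilon> * (2 * integral {t..b} (\<phi> s)) = 0"
    using has_vector_derivative_eqI_unit_interval[OF s \<psi>'[OF s], of "\<lambda>_. 0" 0] by simp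
  moreover have "\<epsilon> \<noteq> 0" using \<epsilon>[of "(0, 0)"] by auto
  ultimately have "integral {t..b} (\<lambda>u. \<epsilon> * \<phi> s u) = 0" by simp
  moreover have "continuous_on {t..b} (\<lambda>u. \<epsilon> * \<phi> s u)"
    unfolding \<phi>_def by (intro continuous_intros wedge_continuous) (use s in auto)
  ultimately have "\<epsilon> * \<phi> s t = 0"
    using integral_eq_0_imp_eq_0[OF tb] \<phi>_nonneg[OF s] tb by fastforce
  then have "\<phi> s t = 0" using \<open>\<epsilon> \<noteq> 0\<close> by simp
  moreover have "area (s, t) \<noteq> 0" using immersed s by (simp add: area_def)
  ultimately show ?thesis using \<phi>_area[OF s, of t] by simp
qed

section \<open>Consequences of \<eta> = 0 for the second derivatives\<close>

lemma wedge_t_eq_0: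
  assumes s: "0 \<le> s" "s \<le> 1"
  shows "wedge_t (s, t) = 0"
proof -
  have "zs (s, t) * wedge_t (s, t) = zt (s, t) * wedge_s (s, t)"
    "ws (s, t) * wedge_t (s, t) = wt (s, t) * wedge_s (s, t)"
    using holomorphic[of "(s, t)"] s unfolding wedge_s_def wedge_t_def by (simp, algebra)+
  moreover have "zs (s, t) \<noteq> 0 \<or> ws (s, t) \<noteq> 0"
    using immersed[of "(s, t)"] s by auto
  ultimately show ?thesis using wedge_s_eq_0[OF s] by auto
qed

text \<open>Differentiating \<eta> = 0 makes x_tt and x_ts parallel to x, as x_t is, hence parallel
  to x_t wherever x \<noteq> 0. The obstacle is that the surface may pass through the
  origin.\<close>

lemma parallel_derivatives:
  assumes s: "0 \<le> s" "s \<le> 1"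
  shows "zt (s, t) * wtt (s, t) = wt (s, t) * ztt (s, t)"
    and "zt (s, t) * wts (s, t) = wt (s, t) * zts (s, t)"
proof -
  note sm = smooth_partials3
  have zt: "zt (s, t) \<noteq> 0 \<or> wt (s, t) \<noteq> 0" for t
    using immersed[of "(s, t)"] s by auto
  have tt: "z (s, t) * wtt (s, t) = w (s, t) * ztt (s, t)" for t
  proof -
    have "((\<lambda>t. wedge_t (s, t)) has_vector_derivative
        (z (s, t) * wtt (s, t) + zt (s, t) * wt (s, t)) - (w (s, t) * ztt (s, t) + wt (s, t) * zt (s, t))) (at t)"
      unfolding wedge_t_def by (intro derivative_intros der sm s)
    from has_vector_derivative_eqI[OF this has_vector_derivative_const] show ?thesis
      using wedge_t_eq_0[OF s] by (simp add: algebra_simps)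
  qed
  have ts: "z (s, t) * wts (s, t) = w (s, t) * zts (s, t)" for t
    using has_vector_derivative_eqI_unit_interval[OF s wedge_t_s[OF s] has_vector_derivative_const]
      wedge_t_eq_0 by (simp add: wedge_st_def)
  have Q: "z (s, t) * wt (s, t) = w (s, t) * zt (s, t)" for t
    using wedge_t_eq_0[OF s] by (simp add: wedge_t_def)
  \<comment> \<open>At a zero of x, differentiating x U = 0 in t leaves x_t U = 0, and x_t \<noteq>
    0. This asks for U to be differentiable, which brings in third derivatives of z and w.\<close>
  have vanish: "U t = 0"
    if U: "(U has_vector_derivative U') (at t)" and zU: "\<And>t. z (s, t) * U t = 0" "\<And>t. w (s, t) * U t = 0"
    for U U' t
  proof (rule ccontr)
    assume "U t \<noteq> 0"
    then have zw: "z (s, t) = 0" "w (s, t) = 0" using zU by (metis mult_eq_0_iff)+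
    have "((\<lambda>t. z (s, t) * U t) has_vector_derivative z (s, t) * U' + zt (s, t) * U t) (at t)"
      "((\<lambda>t. w (s, t) * U t) has_vector_derivative w (s, t) * U' + wt (s, t) * U t) (at t)"
      by (intro derivative_intros der sm s U)+
    from this[THEN has_vector_derivative_eqI, OF has_vector_derivative_const]
    have "z (s, t) * U' + zt (s, t) * U t = 0" "w (s, t) * U' + wt (s, t) * U t = 0"
      using zU by blast+
    then show False using zw zt[of t] \<open>U t \<noteq> 0\<close> by auto
  qed
  have "zt (s, t) * wtt (s, t) - wt (s, t) * ztt (s, t) = 0"
  proof (rule vanish[of "\<lambda>t. zt (s, t) * wtt (s, t) - wt (s, t) * ztt (s, t)"])
    show "((\<lambda>t. zt (s, t) * wtt (s, t) - wt (s, t) * ztt (s, t)) has_vector_derivative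
        (zt (s, t) * partial_t wtt (s, t) + ztt (s, t) * wtt (s, t)) -
        (wt (s, t) * partial_t ztt (s, t) + wtt (s, t) * ztt (s, t))) (at t)"
      by (intro derivative_intros der sm s)
    show "z (s, t) * (zt (s, t) * wtt (s, t) - wt (s, t) * ztt (s, t)) = 0"
      "w (s, t) * (zt (s, t) * wtt (s, t) - wt (s, t) * ztt (s, t)) = 0" for t
      using tt[of t] Q[of t] by algebra+
  qed
  then show "zt (s, t) * wtt (s, t) = wt (s, t) * ztt (s, t)" by simp
  have "zt (s, t) * wts (s, t) - wt (s, t) * zts (s, t) = 0"
  proof (rule vanish[of "\<lambda>t. zt (s, t) * wts (s, t) - wt (s, t) * zts (s, t)"])
    show "((\<lambda>t. zt (s, t) * wts (s, t) - wt (s, t) * zts (s, t)) has_vector_derivative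
        (zt (s, t) * partial_t wts (s, t) + ztt (s, t) * wts (s, t)) -
        (wt (s, t) * partial_t zts (s, t) + wtt (s, t) * zts (s, t))) (at t)"
      by (intro derivative_intros der sm s)
    show "z (s, t) * (zt (s, t) * wts (s, t) - wt (s, t) * zts (s, t)) = 0"
      "w (s, t) * (zt (s, t) * wts (s, t) - wt (s, t) * zts (s, t)) = 0" for t
      using ts[of t] Q[of t] by algebra+
  qed
  then show "zt (s, t) * wts (s, t) = wt (s, t) * zts (s, t)" by simp
qed

section \<open>The logarithmic derivative of x_t and the turning of the circles\<close>

definition speed :: "real \<times> real \<Rightarrow> complex" where
  "speed p = cnj (zt p) * zt p + cnj (wt p) * wt p"

text \<open>Together with \<open>conn_t\<close>, the coefficients of the 1-form d log x_t.
  Projecting hermitian-orthogonally onto x_t avoids dividing by \<open>zt\<close> or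
  \<open>wt\<close>, either of which may vanish. The imaginary part of \<open>conn_t\<close> is the
  rate of turning of x_t.\<close>

definition conn_s :: "real \<times> real \<Rightarrow> complex" where
  "conn_s p = (cnj (zt p) * zts p + cnj (wt p) * wts p) / speed p"

definition conn_t :: "real \<times> real \<Rightarrow> complex" where
  "conn_t p = (cnj (zt p) * ztt p + cnj (wt p) * wtt p) / speed p"

lemma speed_nonzero:
  assumes "0 \<le> s" "s \<le> 1"
  shows "speed (s, t) \<noteq> 0"
proof -
  have "zt (s, t) \<noteq> 0 \<or> wt (s, t) \<noteq> 0"
    using immersed[of "(s, t)"] assms by auto
  then have "(cmod (zt (s, t)))\<^sup>2 + (cmod (wt (s, t)))\<^sup>2 \<noteq> 0"
    by (simp add: sum_power2_eq_zero_iff)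
  moreover have "speed (s, t) = of_real ((cmod (zt (s, t)))\<^sup>2 + (cmod (wt (s, t)))\<^sup>2)"
    by (simp only: speed_def of_real_add complex_norm_square mult.commute[of _ "cnj _"])
  ultimately show ?thesis by (simp only: of_real_eq_0_iff not_False_eq_True)
qed

text \<open>A vector parallel to x_t equals its projection onto x_t; multiplied by
  \<open>speed\<close>, this is a polynomial consequence of
  \<open>parallel_derivatives\<close>.\<close>

lemma conn_eq:
  assumes s: "0 \<le> s" "s \<le> 1"
  shows "ztt (s, t) = conn_t (s, t) * zt (s, t)" "wtt (s, t) = conn_t (s, t) * wt (s, t)"
    "zts (s, t) = conn_s (s, t) * zt (s, t)" "wts (s, t) = conn_s (s, t) * wt (s, t)"
proof -
  note N = speed_nonzero[OF s, of t]
  note par = parallel_derivatives[OF s, of t]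
  have "speed (s, t) * ztt (s, t) = (cnj (zt (s, t)) * ztt (s, t) + cnj (wt (s, t)) * wtt (s, t)) * zt (s, t)"
    "speed (s, t) * wtt (s, t) = (cnj (zt (s, t)) * ztt (s, t) + cnj (wt (s, t)) * wtt (s, t)) * wt (s, t)"
    "speed (s, t) * zts (s, t) = (cnj (zt (s, t)) * zts (s, t) + cnj (wt (s, t)) * wts (s, t)) * zt (s, t)"
    "speed (s, t) * wts (s, t) = (cnj (zt (s, t)) * zts (s, t) + cnj (wt (s, t)) * wts (s, t)) * wt (s, t)"
    using par unfolding speed_def by algebra+
  then show "ztt (s, t) = conn_t (s, t) * zt (s, t)" "wtt (s, t) = conn_t (s, t) * wt (s, t)"
    "zts (s, t) = conn_s (s, t) * zt (s, t)" "wts (s, t) = conn_s (s, t) * wt (s, t)"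
    using N unfolding conn_s_def conn_t_def by (simp_all add: field_simps)
qed

text \<open>The s-derivative of \<open>conn_t\<close> in the form the quotient rule delivers,
  written out so that its continuity can be read off for the Leibniz rule.\<close>

definition curl :: "real \<times> real \<Rightarrow> complex" where
  "curl p =
    (cnj (zt p) * partial_s ztt p + cnj (zts p) * ztt p + (cnj (wt p) * partial_s wtt p + cnj (wts p) * wtt p)) / speed p
    - (cnj (zt p) * ztt p + cnj (wt p) * wtt p) *
      (cnj (zt p) * zts p + cnj (zts p) * zt p + (cnj (wt p) * wts p + cnj (wts p) * wt p)) / (speed p)\<^sup>2"

lemma conn_t_s:
  assumes s: "0 \<le> s" "s \<le> 1"
  shows "((\<lambda>s. conn_t (s, t)) has_vector_derivative curl (s, t)) (at s within {0..1})"
  unfolding conn_t_def curl_def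
  by (rule has_vector_derivative_quotient)
     (use s in \<open>auto simp: speed_nonzero[unfolded speed_def] speed_def intro!: derivative_intros der smooth_partials3\<close>)

text \<open>Closedness of d log x_t. For f = \<open>zt\<close> and f = \<open>wt\<close>, compute
  the mixed second derivative of f in both orders: the products of \<open>conn_s\<close> and
  \<open>conn_t\<close> cancel, leaving \<open>curl\<close> f = l f with l the t-derivative of
  \<open>conn_s\<close>. One of the two f is nonzero.\<close>

lemma conn_s_t:
  assumes s: "0 \<le> s" "s \<le> 1"
  shows "((\<lambda>t. conn_s (s, t)) has_vector_derivative curl (s, t)) (at t)"
proof -
  have num: "((\<lambda>t. cnj (zt (s, t)) * zts (s, t) + cnj (wt (s, t)) * wts (s, t)) has_vector_derivative
      (cnj (zt (s, t)) * partial_t zts (s, t) + cnj (ztt (s, t)) * zts (s, t)) +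
      (cnj (wt (s, t)) * partial_t wts (s, t) + cnj (wtt (s, t)) * wts (s, t))) (at t)"
    and den: "((\<lambda>t. speed (s, t)) has_vector_derivative
      (cnj (zt (s, t)) * ztt (s, t) + cnj (ztt (s, t)) * zt (s, t)) +
      (cnj (wt (s, t)) * wtt (s, t) + cnj (wtt (s, t)) * wt (s, t))) (at t)"
    unfolding speed_def by (intro derivative_intros der smooth_partials3 s)+
  obtain l where l: "((\<lambda>t. conn_s (s, t)) has_vector_derivative l) (at t)"
    using has_vector_derivative_quotient[OF num den speed_nonzero[OF s]] unfolding conn_s_def by blast
  have "curl (s, t) * f (s, t) = l * f (s, t)"
    if f: "smooth_on strip f" and t: "\<And>s t. 0 \<le> s \<Longrightarrow> s \<le> 1 \<Longrightarrow> partial_t f (s, t) = conn_t (s, t) * f (s, t)"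
      and fs: "\<And>s t. 0 \<le> s \<Longrightarrow> s \<le> 1 \<Longrightarrow> partial_s f (s, t) = conn_s (s, t) * f (s, t)" for f
  proof -
    have "((\<lambda>s. conn_t (s, t) * f (s, t)) has_vector_derivative
        conn_t (s, t) * partial_s f (s, t) + curl (s, t) * f (s, t)) (at s within {0..1})"
      by (intro derivative_intros der conn_t_s s f)
    then have "partial_s (partial_t f) (s, t) = conn_t (s, t) * partial_s f (s, t) + curl (s, t) * f (s, t)"
      by (rule has_vector_derivative_eqI_unit_interval[OF s
            partial_s_has_vector_derivative[OF smooth_on_partial_t[OF f] s]]) (rule t)
    moreover have "((\<lambda>t. conn_s (s, t) * f (s, t)) has_vector_derivative
        conn_s (s, t) * partial_t f (s, t) + l * f (s, t)) (at t)"
      by (intro derivative_intros der l s f)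
    then have "partial_t (partial_s f) (s, t) = conn_s (s, t) * partial_t f (s, t) + l * f (s, t)"
      by (rule has_vector_derivative_eqI[OF
            partial_t_has_vector_derivative[OF smooth_on_partial_s[OF f] s]]) (rule fs[OF s])
    ultimately show ?thesis
      using partial_commute[OF f s, of t] t[OF s, of t] fs[OF s, of t] by auto
  qed
  from this[of zt] this[of wt] have "curl (s, t) * zt (s, t) = l * zt (s, t)" "curl (s, t) * wt (s, t) = l * wt (s, t)"
    using smooth_partials conn_eq by blast+
  moreover have "zt (s, t) \<noteq> 0 \<or> wt (s, t) \<noteq> 0"
    using immersed[of "(s, t)"] s by auto
  ultimately have "curl (s, t) = l" by auto
  then show ?thesis using l by simp
qed

lemma conn_continuous:
  assumes "continuous_on T g" "continuous_on T h" "\<And>x. x \<in> T \<Longrightarrow> 0 \<le> g x \<and> g x \<le> 1"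
  shows "continuous_on T (\<lambda>x. conn_t (g x, h x))" "continuous_on T (\<lambda>x. curl (g x, h x))"
proof -
  have sp: "continuous_on T (\<lambda>x. speed (g x, h x))"
    unfolding speed_def
    by (intro continuous_intros smooth_on_strip_compose_continuous smooth_partials assms; simp)
  show "continuous_on T (\<lambda>x. conn_t (g x, h x))" "continuous_on T (\<lambda>x. curl (g x, h x))"
    unfolding conn_t_def curl_def
    by (intro sp continuous_intros smooth_on_strip_compose_continuous smooth_partials3 assms;
        use assms speed_nonzero in simp)+
qed

text \<open>By closedness, the s-derivative of the integral is the integral of the t-derivative of
  the periodic function \<open>conn_s\<close>.\<close>

lemma turning_const: "integral {0..2 * pi} (\<lambda>t. conn_t (0, t)) = integral {0..2 * pi} (\<lambda>t. conn_t (1, t))"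
proof -
  have "((\<lambda>s. integral (cbox 0 (2 * pi)) (\<lambda>t. conn_t (s, t))) has_vector_derivative 0) (at s within {0..1})"
    if s: "s \<in> {0..1}" for s
  proof -
    have "((\<lambda>s. integral (cbox 0 (2 * pi)) (\<lambda>t. conn_t (s, t))) has_vector_derivative
        integral (cbox 0 (2 * pi)) (\<lambda>t. curl (s, t))) (at s within {0..1})"
    proof (rule leibniz_rule_vector_derivative)
      show "(\<lambda>t. conn_t (s, t)) integrable_on cbox 0 (2 * pi)" if "s \<in> {0..1}" for s
        by (intro integrable_continuous conn_continuous continuous_intros) (use that in auto)
      show "continuous_on ({0..1} \<times> cbox 0 (2 * pi)) (\<lambda>(s, t). curl (s, t))"
        unfolding split_beta by (intro conn_continuous continuous_intros) auto
    qed (use s in \<open>auto intro!: conn_t_s\<close>)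
    moreover have "((\<lambda>t. curl (s, t)) has_integral conn_s (s, 2 * pi) - conn_s (s, 0)) {0..2 * pi}"
      by (rule fundamental_theorem_of_calculus)
         (use s in \<open>auto intro!: has_vector_derivative_at_within[OF conn_s_t]\<close>)
    moreover have "conn_s (s, 2 * pi) = conn_s (s, 0)"
      using s partials_periodic_zw[of s 0] partials_periodic(1)[OF smooth_partials(5), of s "2 * pi" 0]
        partials_periodic(1)[OF smooth_partials(6), of s "2 * pi" 0] partials_periodic_zw(2,4)
      unfolding conn_s_def speed_def by simp
    ultimately show ?thesis by (simp add: integral_unique)
  qed
  then obtain c where "\<And>s. s \<in> {0..1} \<Longrightarrow> integral (cbox 0 (2 * pi)) (\<lambda>t. conn_t (s, t)) = c"
    using has_vector_derivative_zero_constant[of "{0..1::real}"] by blast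
  then show ?thesis by simp
qed

text \<open>On the boundary x_t = \<i> k x with k real, because x_t is a complex multiple of the
  unit vector x and the norm of x is constant. Hence Im \<open>conn_t\<close> = k = a *
  \<open>area\<close>. Multiplying by \<open>area\<close> once more leaves the sign of a, whatever
  the orientation.\<close>

lemma boundary_rotation:
  assumes s: "s = 0 \<or> s = 1"
  shows "if s = 1 then 0 < Im (conn_t (s, t)) * area (s, t) else Im (conn_t (s, t)) * area (s, t) < 0"
proof -
  have s': "0 \<le> s" "s \<le> 1" using s by auto
  define r where "r = (\<lambda>t. cnj (z (s, t)) * zt (s, t) + cnj (w (s, t)) * wt (s, t))"
  define k where "k = (\<lambda>t. Im (r t))"
  have r_cnj: "r t + cnj (r t) = 0" for t
  proof -
    have "((\<lambda>t. cnj (z (s, t)) * z (s, t) + cnj (w (s, t)) * w (s, t)) has_vector_derivative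
       (cnj (z (s, t)) * zt (s, t) + cnj (zt (s, t)) * z (s, t)) +
       (cnj (w (s, t)) * wt (s, t) + cnj (wt (s, t)) * w (s, t))) (at t)"
      by (intro derivative_intros der smooth s')
    from has_vector_derivative_eqI[OF this has_vector_derivative_const boundary_sphere[OF s]]
    show ?thesis by (simp add: r_def algebra_simps)
  qed
  have rk: "r t = \<i> * of_real (k t)" for t
    using r_cnj[of t] by (simp add: k_def complex_eq_iff)
  have rot: "zt (s, t) = \<i> * of_real (k t) * z (s, t)" "wt (s, t) = \<i> * of_real (k t) * w (s, t)" for t
  proof -
    have Q: "z (s, t) * wt (s, t) = w (s, t) * zt (s, t)"
      using wedge_t_eq_0[OF s'] by (simp add: wedge_t_def)
    show "zt (s, t) = \<i> * of_real (k t) * z (s, t)" "wt (s, t) = \<i> * of_real (k t) * w (s, t)"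
      using Q boundary_sphere[OF s, of t] unfolding rk[symmetric] r_def by algebra+
  qed
  obtain a b :: real where ab: "if s = 1 then a > 0 else a < 0"
      "z (s, t) = of_real a * zs (s, t) + of_real b * zt (s, t)"
      "w (s, t) = of_real a * ws (s, t) + of_real b * wt (s, t)"
    using boundary_conormal[OF s] by metis
  \<comment> \<open>Insert x = a x_s + b x_t in the conjugated factor: the b-part is b times the
    squared norm of x_t and so is real.\<close>
  have ka: "k t = a * area (s, t)"
    unfolding k_def r_def area_def ab(2,3) by (simp add: algebra_simps)
  have ar: "area (s, t) \<noteq> 0" using immersed s' by (simp add: area_def)
  then have k0: "k t \<noteq> 0" using ka ab(1) by (auto split: if_splits)
  define r' where "r' = (cnj (z (s, t)) * ztt (s, t) + cnj (zt (s, t)) * zt (s, t)) +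
      (cnj (w (s, t)) * wtt (s, t) + cnj (wt (s, t)) * wt (s, t))"
  have r': "(r has_vector_derivative r') (at t)"
    unfolding r_def r'_def by (intro derivative_intros der smooth_partials s')
  define k' where "k' = Im r'"
  have k': "((\<lambda>t. of_real (k t)) has_vector_derivative complex_of_real k') (at t)"
    unfolding k_def k'_def
    by (rule bounded_linear.has_vector_derivative[OF bounded_linear_compose[OF bounded_linear_of_real bounded_linear_Im] r'])
  have tt: "ztt (s, t) = (\<i> * of_real k' + (\<i> * of_real (k t))\<^sup>2) * z (s, t)"
     "wtt (s, t) = (\<i> * of_real k' + (\<i> * of_real (k t))\<^sup>2) * w (s, t)"
  proof -
    have "((\<lambda>t. \<i> * of_real (k t) * z (s, t)) has_vector_derivative
        \<i> * of_real (k t) * zt (s, t) + \<i> * of_real k' * z (s, t)) (at t)"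
      by (intro derivative_intros der smooth s' k')
    from has_vector_derivative_eqI[OF _ this rot(1)] show "ztt (s, t) = (\<i> * of_real k' + (\<i> * of_real (k t))\<^sup>2) * z (s, t)"
      using partial_t_has_vector_derivative[OF smooth_partials(5) s'] rot(1)[of t]
      by (simp add: algebra_simps power2_eq_square)
    have "((\<lambda>t. \<i> * of_real (k t) * w (s, t)) has_vector_derivative
        \<i> * of_real (k t) * wt (s, t) + \<i> * of_real k' * w (s, t)) (at t)"
      by (intro derivative_intros der smooth s' k')
    from has_vector_derivative_eqI[OF _ this rot(2)] show "wtt (s, t) = (\<i> * of_real k' + (\<i> * of_real (k t))\<^sup>2) * w (s, t)"
      using partial_t_has_vector_derivative[OF smooth_partials(6) s'] rot(2)[of t]
      by (simp add: algebra_simps power2_eq_square)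
  qed
  \<comment> \<open>The logarithmic derivative of \<i> k x is k'/k + \<i> k; here it is multiplied
    by \<i> k. The coordinates z and w cannot both vanish on the sphere, so x cancels.\<close>
  have "conn_t (s, t) * (\<i> * of_real (k t)) = \<i> * of_real k' + (\<i> * of_real (k t))\<^sup>2"
  proof -
    have "conn_t (s, t) * (\<i> * of_real (k t)) * z (s, t) = (\<i> * of_real k' + (\<i> * of_real (k t))\<^sup>2) * z (s, t)"
      "conn_t (s, t) * (\<i> * of_real (k t)) * w (s, t) = (\<i> * of_real k' + (\<i> * of_real (k t))\<^sup>2) * w (s, t)"
      using conn_eq(1,2)[OF s', of t] tt unfolding rot[of t] by (simp_all only: mult.assoc)
    then show ?thesis using boundary_sphere[OF s, of t] by (metis add_0 mult_cancel_right mult_zero_right zero_neq_one)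
  qed
  moreover have "of_real (k t) * of_real (k' / k t) = complex_of_real k'"
    using k0 by simp
  ultimately have "\<i> * of_real (k t) * conn_t (s, t) = \<i> * of_real (k t) * (of_real (k' / k t) + \<i> * of_real (k t))"
    by algebra
  then have "conn_t (s, t) = of_real (k' / k t) + \<i> * of_real (k t)"
    using k0 by simp
  then have "Im (conn_t (s, t)) = k t" by simp
  moreover have "if s = 1 then 0 < k t * area (s, t) else k t * area (s, t) < 0"
    using ab(1) ar neq_iff[THEN iffD1, OF ar] unfolding ka by (auto simp: mult.assoc zero_less_mult_iff mult_less_0_iff split: if_splits)
  ultimately show ?thesis by (simp only:)
qed

lemma no_free_boundary: False
proof -
  obtain \<epsilon> :: real where \<epsilon>: "\<And>p. p \<in> strip \<Longrightarrow> 0 < \<epsilon> * area p"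
    using area_sign mult_1 mult_minus1 neg_0_less_iff_less by metis
  define f where "f = (\<lambda>t. \<epsilon> * Im (conn_t (1, t) - conn_t (0, t)))"
  have cont: "continuous_on {0..2 * pi} (\<lambda>t. conn_t (1, t))" "continuous_on {0..2 * pi} (\<lambda>t. conn_t (0, t))"
    by (intro conn_continuous continuous_intros; simp)+
  have pos: "0 < f t" for t
  proof -
    have "0 < \<epsilon> * Im (conn_t (1, t))"
      using boundary_rotation[of 1 t] \<epsilon>[of "(1, t)"] by (auto simp: zero_less_mult_iff)
    moreover have "\<epsilon> * Im (conn_t (0, t)) < 0"
      using boundary_rotation[of 0 t] \<epsilon>[of "(0, t)"] by (auto simp: zero_less_mult_iff mult_less_0_iff)
    ultimately show ?thesis by (simp add: f_def algebra_simps)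
  qed
  have "((\<lambda>t. conn_t (1, t) - conn_t (0, t)) has_integral 0) {0..2 * pi}"
    using has_integral_diff[OF integrable_integral integrable_integral,
        OF integrable_continuous_interval integrable_continuous_interval, OF cont] turning_const by simp
  then have "(f has_integral \<epsilon> * Im 0) {0..2 * pi}"
    unfolding f_def by (intro has_integral_mult_right has_integral_Im)
  then have "integral {0..2 * pi} f = 0" by (simp add: integral_unique)
  moreover have "continuous_on {0..2 * pi} f"
    unfolding f_def by (intro continuous_intros cont)
  ultimately have "f 0 = 0"
    using integral_eq_0_imp_eq_0[of 0 "2 * pi" f 0] less_imp_le[OF pos] by simp
  with pos[of 0] show False by simp
qed

end

subsection \<open>Minimal Lagrangian surfaces\<close>

definition herm :: "complex ^ 2 \<Rightarrow> complex ^ 2 \<Rightarrow> complex" where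
  "herm a b = a $ 1 * cnj (b $ 1) + a $ 2 * cnj (b $ 2)"

definition cdet :: "complex ^ 2 \<Rightarrow> complex ^ 2 \<Rightarrow> complex" where
  "cdet a b = a $ 1 * b $ 2 - a $ 2 * b $ 1"

lemma inner_eq_Re_herm: "a \<bullet> b = Re (herm a b)"
  by (simp add: herm_def inner_vec_def sum_2 inner_complex_def)

lemma inner_cplx_J: "a \<bullet> cplx_J b = Im (herm a b)"
  by (simp add: herm_def inner_vec_def sum_2 inner_complex_def cplx_J_def)

lemma herm_commute: "herm b a = cnj (herm a b)"
  by (simp add: herm_def)

lemma herm_self: "herm a a = of_real (a \<bullet> a)"
  by (simp add: herm_def inner_vec_def sum_2 inner_complex_def complex_eq_iff)

text \<open>Multiplicativity of the determinant, for the matrix with rows a, b times the conjugate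
  transpose of the one with rows c, d.\<close>

lemma cdet_mult_cnj_cdet: "cdet a b * cnj (cdet c d) = herm a c * herm b d - herm a d * herm b c"
  by (simp add: cdet_def herm_def algebra_simps)

lemma herm_self_real: "Im (herm a a) = 0" "Re (herm a a) = a \<bullet> a"
  by (simp_all add: herm_self)

text \<open>
  Differentiating \<open>Im (herm p q) = 0\<close> gives the hypotheses \<open>Im (herm a q) = Im (herm b p)\<close> and
  \<open>Im (herm b q) = Im (herm c p)\<close>, i.e. the symmetry of the cubic form of a Lagrangian surface; the
  imaginary part is then the mean curvature tested against \<open>J p\<close> and \<open>J q\<close>.
\<close>

lemma Im_cdet_derivatives:
  assumes pq: "Im (herm p q) = 0" and sym: "Im (herm a q) = Im (herm b p)" "Im (herm b q) = Im (herm c p)"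
    and H: "\<And>v. v \<in> {p, q} \<Longrightarrow>
      (q \<bullet> q) * Im (herm a v) - 2 * (p \<bullet> q) * Im (herm b v) + (p \<bullet> p) * Im (herm c v) = 0"
  shows "Im ((cdet a q + cdet p b) * cnj (cdet p q)) = 0" "Im ((cdet b q + cdet p c) * cnj (cdet p q)) = 0"
proof -
  have pq': "Im (herm q p) = 0" "Re (herm p q) = p \<bullet> q" "Re (herm q p) = p \<bullet> q"
    using pq by (simp_all add: herm_commute[of q p] inner_eq_Re_herm)
  show "Im ((cdet a q + cdet p b) * cnj (cdet p q)) = 0" "Im ((cdet b q + cdet p c) * cnj (cdet p q)) = 0"
    using H[of p] H[of q] sym pq'
    by (simp_all add: distrib_right cdet_mult_cnj_cdet herm_self_real pq algebra_simps)
qed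

section \<open>Induced metric, conormal and mean curvature in coordinates\<close>

lemma normal_part:
  assumes "subspace T"
  shows "normal_part T v \<in> orthogonal_comp T" "v - normal_part T v \<in> T"
proof -
  obtain y z where yz: "y \<in> span T" "\<And>u. u \<in> span T \<Longrightarrow> orthogonal z u" "v = y + z"
    using orthogonal_subspace_decomp_exists by blast
  have sp: "span T = T" using assms by (simp add: span_eq_iff)
  have "\<exists>!u. u \<in> orthogonal_comp T \<and> v - u \<in> T"
  proof
    show "z \<in> orthogonal_comp T \<and> v - z \<in> T"
      using yz sp by (auto simp: orthogonal_comp_def orthogonal_commute)
  next
    fix u assume u: "u \<in> orthogonal_comp T \<and> v - u \<in> T"
    have "v - u - y \<in> T" using subspace_diff[OF assms, of "v - u" y] u yz(1) sp by simp
    then have d: "z - u \<in> T" using yz(3) by simp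
    have "orthogonal (z - u) z" "orthogonal (z - u) u"
      using d u yz(2)[of "z - u"] sp by (auto simp: orthogonal_comp_def orthogonal_commute)
    then have "(z - u) \<bullet> (z - u) = 0"
      by (simp add: orthogonal_def inner_diff_right)
    then show "u = z" by simp
  qed
  from theI'[OF this] show "normal_part T v \<in> orthogonal_comp T" "v - normal_part T v \<in> T"
    unfolding normal_part_def by auto
qed

lemma normal_part_inner:
  assumes "subspace T" "n \<in> orthogonal_comp T"
  shows "normal_part T v \<bullet> n = v \<bullet> n"
  using normal_part(2)[OF assms(1), of v] assms(2)
  by (auto simp: orthogonal_comp_def orthogonal_def inner_diff_left)

lemma diff1_eq:
  assumes "smooth_on strip X" "p \<in> strip"
  shows "diff1 X p v = fst v *\<^sub>R partial_s X p + snd v *\<^sub>R partial_t X p"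
  unfolding diff1_def by (rule frechet_derivative_strip_eq_partials[OF assms])

lemma gram_pos:
  assumes X: "smooth_on strip X" "p \<in> strip" and inj: "inj (diff1 X p)"
  shows "0 < partial_t X p \<bullet> partial_t X p"
    "0 < (partial_s X p \<bullet> partial_s X p) * (partial_t X p \<bullet> partial_t X p) - (partial_s X p \<bullet> partial_t X p)\<^sup>2"
proof -
  define a b where "a = partial_s X p" "b = partial_t X p"
  have indep: "u = 0 \<and> v = 0" if "u *\<^sub>R a + v *\<^sub>R b = 0" for u v
    using that injD[OF inj, of "(u, v)" "(0, 0)"] by (simp add: diff1_eq[OF X] a_b_def)
  have "b \<noteq> 0" using indep[of 0 1] by auto
  then show G: "0 < partial_t X p \<bullet> partial_t X p" by (simp add: a_b_def)
  \<comment> \<open>This is \<open>b \<bullet> b\<close> times the component of a orthogonal to b,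
    so its squared norm is \<open>b \<bullet> b\<close> times the Gram determinant.\<close>
  define y where "y = (b \<bullet> b) *\<^sub>R a + (- (a \<bullet> b)) *\<^sub>R b"
  have "y \<noteq> 0" using indep[of "b \<bullet> b" "- (a \<bullet> b)"] \<open>b \<noteq> 0\<close> by (auto simp: y_def)
  then have "0 < y \<bullet> y" by simp
  also have "y \<bullet> y = (b \<bullet> b) * ((a \<bullet> a) * (b \<bullet> b) - (a \<bullet> b)\<^sup>2)"
    by (simp add: y_def inner_add_left inner_add_right inner_commute[of b a] power2_eq_square algebra_simps)
  finally show "0 < (partial_s X p \<bullet> partial_s X p) * (partial_t X p \<bullet> partial_t X p) - (partial_s X p \<bullet> partial_t X p)\<^sup>2"
    using G unfolding a_b_def[symmetric] by (simp add: zero_less_mult_iff)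
qed

text \<open>The conormal is a definite description, so existence and uniqueness come first: the
  tangent vectors orthogonal to x_t form the line spanned by n, and the outward condition selects
  one of its two unit vectors.\<close>

lemma outward_conormal_spec:
  assumes X: "smooth_on strip X" "p \<in> strip" and inj: "inj (diff1 X p)"
  obtains w where "outward_conormal X p = diff1 X p w" "if fst p = 1 then fst w > 0 else fst w < 0"
proof -
  define a b where "a = partial_s X p" "b = partial_t X p"
  note d = diff1_eq[OF X, folded a_b_def]
  define n where "n = (b \<bullet> b) *\<^sub>R a - (a \<bullet> b) *\<^sub>R b"
  have G: "0 < b \<bullet> b" using gram_pos(1)[OF assms] by (simp add: a_b_def)
  \<comment> \<open>A sign that merges the outward conditions of the two sides into one
    inequality.\<close>
  define \<sigma> :: real where "\<sigma> = (if fst p = 1 then 1 else - 1)"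
  have sgn: "(if fst p = 1 then fst w > 0 else fst w < 0) \<longleftrightarrow> 0 < \<sigma> * fst w" for w :: "real \<times> real"
    by (simp add: \<sigma>_def)
  have "n \<noteq> 0"
  proof
    assume "n = 0"
    then have "diff1 X p (b \<bullet> b, - (a \<bullet> b)) = diff1 X p (0, 0)" by (simp add: d n_def)
    from injD[OF inj this] G show False by simp
  qed
  then have n: "0 < norm n" by simp
  have nb: "n \<bullet> b = 0" by (simp add: n_def inner_diff_left)
  have "\<exists>!\<nu>. norm \<nu> = 1 \<and> orthogonal \<nu> b \<and> (\<exists>w. \<nu> = diff1 X p w \<and> 0 < \<sigma> * fst w)"
  proof
    show "norm ((\<sigma> / norm n) *\<^sub>R n) = 1 \<and> orthogonal ((\<sigma> / norm n) *\<^sub>R n) b \<and>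
        (\<exists>w. (\<sigma> / norm n) *\<^sub>R n = diff1 X p w \<and> 0 < \<sigma> * fst w)"
    proof (intro conjI exI)
      show "(\<sigma> / norm n) *\<^sub>R n = diff1 X p (\<sigma> / norm n * (b \<bullet> b), - (\<sigma> / norm n * (a \<bullet> b)))"
        by (simp add: d n_def scaleR_diff_right)
      show "0 < \<sigma> * fst (\<sigma> / norm n * (b \<bullet> b), - (\<sigma> / norm n * (a \<bullet> b)))"
        using n G by (simp add: \<sigma>_def)
      show "norm ((\<sigma> / norm n) *\<^sub>R n) = 1" using n by (simp add: \<sigma>_def)
      show "orthogonal ((\<sigma> / norm n) *\<^sub>R n) b" using nb by (simp add: orthogonal_def)
    qed
  next
    fix \<nu> assume \<nu>: "norm \<nu> = 1 \<and> orthogonal \<nu> b \<and> (\<exists>w. \<nu> = diff1 X p w \<and> 0 < \<sigma> * fst w)"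
    then obtain u v where w: "\<nu> = u *\<^sub>R a + v *\<^sub>R b" "0 < \<sigma> * u" by (auto simp: d)
    have "v * (b \<bullet> b) = - u * (a \<bullet> b)"
      using \<nu> by (simp add: w orthogonal_def inner_add_left)
    then have "(b \<bullet> b) *\<^sub>R \<nu> = u *\<^sub>R n"
      by (simp add: w n_def scaleR_add_right scaleR_diff_right mult.commute)
    then have eq: "\<nu> = (u / (b \<bullet> b)) *\<^sub>R n"
      using G by (simp add: eq_vector_fraction_iff)
    have "norm \<nu> = \<sigma> * u / (b \<bullet> b) * norm n"
      using w(2) G unfolding eq by (auto simp: \<sigma>_def split: if_splits)
    then have "u / (b \<bullet> b) = \<sigma> / norm n"
      using \<nu> n by (auto simp: \<sigma>_def field_simps split: if_splits)
    then show "\<nu> = (\<sigma> / norm n) *\<^sub>R n" using eq by simp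
  qed
  from theI'[OF this] have "\<exists>w. outward_conormal X p = diff1 X p w \<and> 0 < \<sigma> * fst w"
    unfolding outward_conormal_def sgn using d[of "(0, 1)"] by simp
  then show ?thesis using that sgn by blast
qed

text \<open>Pairing with a normal vector makes the normal projection in the second fundamental form
  invisible, and the Gram determinant in the denominator is positive.\<close>

lemma minimal_inner:
  assumes X: "smooth_on strip X" "p \<in> strip" and inj: "inj (diff1 X p)"
    and H: "mean_curvature_vector X p = 0" and n: "n \<in> orthogonal_comp (tangent_plane X p)"
  shows "(partial_t X p \<bullet> partial_t X p) * (partial_s (partial_s X) p \<bullet> n)
    - 2 * (partial_s X p \<bullet> partial_t X p) * (partial_s (partial_t X) p \<bullet> n)
    + (partial_s X p \<bullet> partial_s X p) * (partial_t (partial_t X) p \<bullet> n) = 0"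
proof -
  have d: "diff1 Y q (1, 0) = partial_s Y q" "diff1 Y q (0, 1) = partial_t Y q" for Y q
    by (simp_all add: diff1_def partial_s_def partial_t_def)
  have "linear (diff1 X p)"
    unfolding diff1_def[abs_def] using smooth_on_has_derivative[OF X] has_derivative_linear by blast
  then have T: "subspace (tangent_plane X p)"
    unfolding tangent_plane_def using linear_subspace_image subspace_UNIV by blast
  have B: "second_fundamental_form X p u v \<bullet> n = diff2 X p u v \<bullet> n" for u v
    unfolding second_fundamental_form_def by (rule normal_part_inner[OF T n])
  have "(partial_t X p \<bullet> partial_t X p) *\<^sub>R second_fundamental_form X p (1, 0) (1, 0)
    - (2 * (partial_s X p \<bullet> partial_t X p)) *\<^sub>R second_fundamental_form X p (1, 0) (0, 1)
    + (partial_s X p \<bullet> partial_s X p) *\<^sub>R second_fundamental_form X p (0, 1) (0, 1) = 0" (is "?S = 0")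
    using H gram_pos(2)[OF X inj] by (simp add: mean_curvature_vector_def Let_def d)
  then have "?S \<bullet> n = 0" by simp
  then show ?thesis
    by (simp add: inner_add_left inner_diff_left B diff2_def d)
qed

section \<open>Lagrangian tangent planes and constancy of their phase\<close>

lemma partials_in_tangent_plane:
  assumes "smooth_on strip X" "p \<in> strip"
  shows "partial_s X p \<in> tangent_plane X p" "partial_t X p \<in> tangent_plane X p"
proof -
  have "partial_s X p = diff1 X p (1, 0)" "partial_t X p = diff1 X p (0, 1)"
    by (simp_all add: diff1_eq[OF assms])
  then show "partial_s X p \<in> tangent_plane X p" "partial_t X p \<in> tangent_plane X p"
    unfolding tangent_plane_def by blast+
qed

lemma cplx_J_normal:
  assumes "smooth_on strip X" "p \<in> strip"
    and "cplx_J ` tangent_plane X p = orthogonal_comp (tangent_plane X p)"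
    and "v \<in> {partial_s X p, partial_t X p}"
  shows "cplx_J v \<in> orthogonal_comp (tangent_plane X p)"
  using partials_in_tangent_plane[OF assms(1,2)] assms(3,4) by blast

lemma lagrangian_herm_real:
  assumes "smooth_on strip X" "p \<in> strip"
    and "cplx_J ` tangent_plane X p = orthogonal_comp (tangent_plane X p)"
  shows "Im (herm (partial_s X p) (partial_t X p)) = 0"
  using cplx_J_normal[OF assms, of "partial_t X p"] partials_in_tangent_plane[OF assms(1,2)]
  by (auto simp: orthogonal_comp_def orthogonal_def inner_cplx_J)

text \<open>On a Lagrangian plane the hermitian Gram matrix is real, so the squared modulus of
  \<open>cdet\<close> is the real Gram determinant.\<close>

lemma cdet_nonzero:
  assumes "smooth_on strip X" "p \<in> strip" "inj (diff1 X p)"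
    and "Im (herm (partial_s X p) (partial_t X p)) = 0"
  shows "cdet (partial_s X p) (partial_t X p) \<noteq> 0"
proof
  let ?a = "partial_s X p" and ?b = "partial_t X p"
  assume "cdet ?a ?b = 0"
  then have "herm ?a ?a * herm ?b ?b = herm ?a ?b * herm ?b ?a"
    using cdet_mult_cnj_cdet[of ?a ?b ?a ?b] by simp
  moreover have "herm ?a ?b = of_real (?a \<bullet> ?b)" "herm ?b ?a = of_real (?a \<bullet> ?b)"
    using assms(4) by (simp_all add: herm_commute[of ?b ?a] inner_eq_Re_herm complex_eq_iff)
  ultimately have "complex_of_real ((?a \<bullet> ?a) * (?b \<bullet> ?b)) = of_real ((?a \<bullet> ?b)\<^sup>2)"
    by (simp add: herm_self power2_eq_square)
  then have "(?a \<bullet> ?a) * (?b \<bullet> ?b) = (?a \<bullet> ?b)\<^sup>2"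
    using of_real_eq_iff by blast
  then show False using gram_pos(2)[OF assms(1-3)] by simp
qed

text \<open>The argument of \<open>D\<close> is the Lagrangian angle, whose differential is the mean
  curvature form up to a constant factor. The conclusion says that \<open>D p\<close> is a real
  multiple of \<open>D (0, 0)\<close>.\<close>

lemma cdet_phase_constant:
  assumes X: "smooth_on strip X" and inj: "\<And>p. p \<in> strip \<Longrightarrow> inj (diff1 X p)"
    and lag: "\<And>p. p \<in> strip \<Longrightarrow> cplx_J ` tangent_plane X p = orthogonal_comp (tangent_plane X p)"
    and min: "\<And>p. p \<in> strip \<Longrightarrow> mean_curvature_vector X p = 0"
    and p: "p \<in> strip"
  defines "D \<equiv> \<lambda>p. cdet (partial_s X p) (partial_t X p)"
  shows "D p * cnj (D (0, 0)) = cnj (D p) * D (0, 0)"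
proof -
  note sm = X smooth_on_partial_s[OF X] smooth_on_partial_t[OF X]
  note nth = bounded_linear.has_vector_derivative[OF bounded_linear_vec_nth]
  note ders = partial_s_has_vector_derivative[OF sm(2)] partial_s_has_vector_derivative[OF sm(3)]
    partial_t_has_vector_derivative[OF sm(2)] partial_t_has_vector_derivative[OF sm(3)]
  have comm: "partial_t (partial_s X) (s, t) = partial_s (partial_t X) (s, t)" if "0 \<le> s" "s \<le> 1" for s t
    using partial_commute[OF X that] by simp
  note normal = cplx_J_normal[OF X _ lag] and pq = lagrangian_herm_real[OF X _ lag]
  have D0: "D p \<noteq> 0" if "p \<in> strip" for p
    unfolding D_def by (rule cdet_nonzero[OF X that inj[OF that] pq[OF that that]])
  define Ds where "Ds = (\<lambda>p. cdet (partial_s (partial_s X) p) (partial_t X p) + cdet (partial_s X p) (partial_s (partial_t X) p))"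
  define Dt where "Dt = (\<lambda>p. cdet (partial_s (partial_t X) p) (partial_t X p) + cdet (partial_s X p) (partial_t (partial_t X) p))"
  have D_s: "((\<lambda>s. D (s, t)) has_vector_derivative Ds (s, t)) (at s within {0..1})" if s: "0 \<le> s" "s \<le> 1" for s t
  proof -
    have "((\<lambda>s. D (s, t)) has_vector_derivative
       (partial_s X (s, t) $ 1 * partial_s (partial_t X) (s, t) $ 2 + partial_s (partial_s X) (s, t) $ 1 * partial_t X (s, t) $ 2) -
       (partial_s X (s, t) $ 2 * partial_s (partial_t X) (s, t) $ 1 + partial_s (partial_s X) (s, t) $ 2 * partial_t X (s, t) $ 1))
       (at s within {0..1})"
      unfolding D_def cdet_def by (intro derivative_intros nth ders s)
    then show ?thesis by (simp add: Ds_def cdet_def algebra_simps)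
  qed
  have D_t: "((\<lambda>t. D (s, t)) has_vector_derivative Dt (s, t)) (at t)" if s: "0 \<le> s" "s \<le> 1" for s t
  proof -
    have "((\<lambda>t. D (s, t)) has_vector_derivative
       (partial_s X (s, t) $ 1 * partial_t (partial_t X) (s, t) $ 2 + partial_t (partial_s X) (s, t) $ 1 * partial_t X (s, t) $ 2) -
       (partial_s X (s, t) $ 2 * partial_t (partial_t X) (s, t) $ 1 + partial_t (partial_s X) (s, t) $ 2 * partial_t X (s, t) $ 1))
       (at t)"
      unfolding D_def cdet_def by (intro derivative_intros nth ders s)
    then show ?thesis by (simp add: Dt_def cdet_def comm[OF s] algebra_simps)
  qed
  \<comment> \<open>Differentiate Im herm (x_s, x_t) = 0 in s; exchanging the arguments of
    \<open>herm\<close> in the second term changes the sign of its imaginary part.\<close>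
  have sym_s: "Im (herm (partial_s (partial_s X) (s, t)) (partial_t X (s, t)))
      = Im (herm (partial_s (partial_t X) (s, t)) (partial_s X (s, t)))" if s: "0 \<le> s" "s \<le> 1" for s t
  proof -
    have "((\<lambda>s. herm (partial_s X (s, t)) (partial_t X (s, t))) has_vector_derivative
        (partial_s X (s, t) $ 1 * cnj (partial_s (partial_t X) (s, t) $ 1) + partial_s (partial_s X) (s, t) $ 1 * cnj (partial_t X (s, t) $ 1)) +
        (partial_s X (s, t) $ 2 * cnj (partial_s (partial_t X) (s, t) $ 2) + partial_s (partial_s X) (s, t) $ 2 * cnj (partial_t X (s, t) $ 2)))
        (at s within {0..1})"
      unfolding herm_def by (intro derivative_intros has_vector_derivative_cnj nth ders s)
    from has_vector_derivative_eqI_unit_interval[OF s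
        bounded_linear.has_vector_derivative[OF bounded_linear_Im this] has_vector_derivative_const[of 0]]
    show ?thesis using pq by (simp add: herm_def algebra_simps)
  qed
  have sym_t: "Im (herm (partial_s (partial_t X) (s, t)) (partial_t X (s, t)))
      = Im (herm (partial_t (partial_t X) (s, t)) (partial_s X (s, t)))" if s: "0 \<le> s" "s \<le> 1" for s t
  proof -
    have "((\<lambda>t. herm (partial_s X (s, t)) (partial_t X (s, t))) has_vector_derivative
        (partial_s X (s, t) $ 1 * cnj (partial_t (partial_t X) (s, t) $ 1) + partial_t (partial_s X) (s, t) $ 1 * cnj (partial_t X (s, t) $ 1)) +
        (partial_s X (s, t) $ 2 * cnj (partial_t (partial_t X) (s, t) $ 2) + partial_t (partial_s X) (s, t) $ 2 * cnj (partial_t X (s, t) $ 2)))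
        (at t)"
      unfolding herm_def by (intro derivative_intros has_vector_derivative_cnj nth ders s)
    from has_vector_derivative_eqI[OF
        bounded_linear.has_vector_derivative[OF bounded_linear_Im this] has_vector_derivative_const[of 0]]
    show ?thesis using pq s by (simp add: herm_def comm[OF s] algebra_simps)
  qed
  \<comment> \<open>The two conclusions of \<open>Im_cdet_derivatives\<close> with p, q = x_s, x_t
    and a, b, c = x_ss, x_st, x_tt; its hypothesis on v is minimality tested against the normals J
    x_s and J x_t.\<close>
  have real: "Im (Ds (s, t) * cnj (D (s, t))) = 0" "Im (Dt (s, t) * cnj (D (s, t))) = 0"
    if s: "0 \<le> s" "s \<le> 1" for s t
  proof -
    have st: "(s, t) \<in> strip" using s by simp
    note I = Im_cdet_derivatives[OF pq[OF st st] sym_s[OF s] sym_t[OF s]]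
    note M = minimal_inner[OF X st inj[OF st] min[OF st] normal[OF st st], unfolded inner_cplx_J]
    show "Im (Ds (s, t) * cnj (D (s, t))) = 0" "Im (Dt (s, t) * cnj (D (s, t))) = 0"
      unfolding Ds_def Dt_def D_def by (rule I, rule M, assumption)+
  qed
  \<comment> \<open>The square of the phase, which needs no choice of argument. Its derivative
    vanishes exactly when D' cnj D is real.\<close>
  define Q where "Q = (\<lambda>p. D p / cnj (D p))"
  have quot0: "e / cnj d - d * cnj e / (cnj d)\<^sup>2 = 0" if "d \<noteq> 0" "Im (e * cnj d) = 0" for d e :: complex
  proof -
    have "e * cnj d = d * cnj e" using that(2) by (simp add: complex_eq_iff algebra_simps)
    then show ?thesis using that(1) by (simp add: field_simps power2_eq_square)
  qed
  have Q_s: "((\<lambda>s. Q (s, t)) has_vector_derivative 0) (at s within {0..1})" if "s \<in> {0..1}" for s t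
  proof -
    have s: "0 \<le> s" "s \<le> 1" using that by auto
    have "D (s, t) \<noteq> 0" using D0 s by simp
    then show ?thesis
      using has_vector_derivative_quotient[OF D_s[OF s, of t] has_vector_derivative_cnj[OF D_s[OF s, of t]]]
        quot0[OF _ real(1)[OF s]] by (simp add: Q_def)
  qed
  have Q_t: "((\<lambda>t. Q (0, t)) has_vector_derivative 0) (at t within UNIV)" for t
  proof -
    have "D (0, t) \<noteq> 0" using D0 by simp
    then show ?thesis
      using has_vector_derivative_quotient[OF D_t[of 0 t] has_vector_derivative_cnj[OF D_t[of 0 t]]]
        quot0[OF _ real(2)[of 0 t]] by (simp add: Q_def)
  qed
  obtain s t where st: "p = (s, t)" "0 \<le> s" "s \<le> 1" using p by (cases p) auto
  have "Q (s, t) = Q (0, t)"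
    using has_vector_derivative_zero_constant[of "{0..1::real}", OF _ Q_s[of _ t]] st by fastforce
  also have "\<dots> = Q (0, 0)"
    using has_vector_derivative_zero_constant[of "UNIV :: real set", OF _ Q_t] by fastforce
  finally have "D p / cnj (D p) = D (0, 0) / cnj (D (0, 0))" by (simp add: Q_def st)
  then show ?thesis using D0[OF p] D0[of "(0, 0)"] by (simp add: field_simps)
qed

section \<open>The hyperkaehler rotation and the conclusion\<close>

text \<open>
  Up to the rotation by \<open>\<gamma>\<close>, these are complex coordinates for the complex structure \<open>K\<close> of the
  hyperkaehler triple on \<open>\<complex>\<^sup>2\<close> whose holomorphic area form is
  \<open>\<omega> + \<i> Im (\<gamma>\<^sup>2 dz\<^sub>1 \<and> dz\<^sub>2)\<close>.
\<close>

definition hk_z :: "complex \<Rightarrow> complex ^ 2 \<Rightarrow> complex" where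
  "hk_z \<gamma> v = Complex (Re (\<gamma> * v $ 1)) (- Re (\<gamma> * v $ 2))"

definition hk_w :: "complex \<Rightarrow> complex ^ 2 \<Rightarrow> complex" where
  "hk_w \<gamma> v = Complex (Im (\<gamma> * v $ 1)) (Im (\<gamma> * v $ 2))"

lemma bounded_linear_hk: "bounded_linear (hk_z \<gamma>)" "bounded_linear (hk_w \<gamma>)"
  unfolding linear_conv_bounded_linear[symmetric]
  by (rule linearI; simp add: hk_z_def hk_w_def complex_eq_iff algebra_simps)+

text \<open>This is dz wedge dw on the pair a, b. Its real part vanishes on Lagrangian planes, and
  its imaginary part vanishes once \<gamma> is adapted to the constant phase, so minimal Lagrangian
  surfaces become complex curves.\<close>

lemma hk_wedge:
  "hk_z \<gamma> a * hk_w \<gamma> b - hk_z \<gamma> b * hk_w \<gamma> a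
    = Complex (- (cmod \<gamma>)\<^sup>2 * Im (herm a b)) (Im (\<gamma>\<^sup>2 * cdet a b))"
proof -
  have "cmod \<gamma> ^ 2 = Re \<gamma> ^ 2 + Im \<gamma> ^ 2" by (rule cmod_power2)
  then show ?thesis
    by (simp add: hk_z_def hk_w_def herm_def cdet_def complex_eq_iff power2_eq_square algebra_simps)
qed

text \<open>The rotation scales the Euclidean metric by a constant, which is 1 for the \<gamma>
  chosen later; the sphere and the Gram matrix are then preserved.\<close>

lemma hk_inner:
  "Re (cnj (hk_z \<gamma> a) * hk_z \<gamma> b + cnj (hk_w \<gamma> a) * hk_w \<gamma> b) = (cmod \<gamma>)\<^sup>2 * (a \<bullet> b)"
proof -
  have "cmod \<gamma> ^ 2 = Re \<gamma> ^ 2 + Im \<gamma> ^ 2" by (rule cmod_power2)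
  then show ?thesis
    by (simp add: hk_z_def hk_w_def inner_eq_Re_herm herm_def complex_eq_iff power2_eq_square algebra_simps)
qed

theorem corollary3p2:
  shows "\<not> (\<exists>x :: real \<times> complex \<Rightarrow> complex ^ 2.
            annulus_immersion x \<and> x ` annulus \<subseteq> cball 0 1 \<and>
            lagrangian x \<and> minimal x \<and> legendrian_free_boundary x)"
proof (rule notI, elim exE conjE)
  fix x :: "real \<times> complex \<Rightarrow> complex ^ 2"
  assume imm: "annulus_immersion x" and lag: "lagrangian x" and min: "minimal x"
    and bd: "legendrian_free_boundary x"
  define X where "X = annulus_lift x"
  have X: "smooth_on strip X" and inj: "\<And>p. p \<in> strip \<Longrightarrow> inj (diff1 X p)"
    using imm by (auto simp: annulus_immersion_def X_def)
  have lag': "\<And>p. p \<in> strip \<Longrightarrow> cplx_J ` tangent_plane X p = orthogonal_comp (tangent_plane X p)"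
    using lag by (auto simp: lagrangian_def X_def)
  have min': "\<And>p. p \<in> strip \<Longrightarrow> mean_curvature_vector X p = 0"
    using min by (auto simp: minimal_def X_def)
  define D0 where "D0 = cdet (partial_s X (0, 0)) (partial_t X (0, 0))"
  \<comment> \<open>The complex area form is rotated by the square of \<gamma>, hence the square
    root: this choice makes it real at (0, 0), and constancy of the phase extends that to the whole
    strip.\<close>
  define \<gamma> where "\<gamma> = csqrt (cnj (sgn D0))"
  define z w where "z = (\<lambda>p. hk_z \<gamma> (X p))" and "w = (\<lambda>p. hk_w \<gamma> (X p))"
  have per: "X (s, t + 2 * pi) = X (s, t)" for s t
    by (simp add: X_def annulus_lift_def cis_mult[symmetric])
  have part: "partial_s z p = hk_z \<gamma> (partial_s X p)" "partial_t z p = hk_z \<gamma> (partial_t X p)"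
    "partial_s w p = hk_w \<gamma> (partial_s X p)" "partial_t w p = hk_w \<gamma> (partial_t X p)" if "p \<in> strip" for p
    unfolding z_def w_def using partials_bounded_linear[OF bounded_linear_hk(1) X that]
      partials_bounded_linear[OF bounded_linear_hk(2) X that] by auto
  have lag0: "Im (herm (partial_s X p) (partial_t X p)) = 0" if "p \<in> strip" for p
    by (rule lagrangian_herm_real[OF X that lag'[OF that]])
  have "D0 \<noteq> 0"
    unfolding D0_def by (rule cdet_nonzero[OF X _ inj lag0]) auto
  then have "cmod (\<gamma>\<^sup>2) = 1" by (simp add: \<gamma>_def norm_sgn)
  then have \<gamma>: "(cmod \<gamma>)\<^sup>2 = 1" by (simp add: norm_power)
  have phase: "Im (\<gamma>\<^sup>2 * cdet (partial_s X p) (partial_t X p)) = 0" if "p \<in> strip" for p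
  proof -
    let ?D = "cdet (partial_s X p) (partial_t X p)"
    have "?D * cnj D0 = cnj ?D * D0"
      unfolding D0_def by (rule cdet_phase_constant[OF X inj lag' min' that])
    then have "Im (?D * cnj D0) = 0" by (simp add: complex_eq_iff mult.commute)
    moreover have "\<gamma>\<^sup>2 * ?D = (?D * cnj D0) /\<^sub>R cmod D0"
      by (simp add: \<gamma>_def sgn_div_norm)
    ultimately show ?thesis by (simp only: scaleR_complex.sel mult_zero_right)
  qed
  have holo: "partial_s z p * partial_t w p = partial_t z p * partial_s w p" if "p \<in> strip" for p
    using hk_wedge[of \<gamma> "partial_s X p" "partial_t X p"]
    unfolding part[OF that] lag0[OF that] phase[OF that] mult_zero_right zero_complex.code[symmetric]
    by simp
  have hk_self: "cnj (hk_z \<gamma> v) * hk_z \<gamma> v + cnj (hk_w \<gamma> v) * hk_w \<gamma> v = of_real (v \<bullet> v)" for v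
    using hk_inner[of \<gamma> v v] \<gamma> by (simp add: complex_eq_iff)
  have point: "norm (X p) = 1" "\<exists>w. X p = diff1 X p w \<and> (if fst p = 1 then fst w > 0 else fst w < 0)"
    if p: "p \<in> strip_boundary" for p
  proof -
    have strip: "p \<in> strip" using p by (auto simp: strip_boundary_def strip_def)
    obtain s t where st: "p = (s, t)" "s \<in> {0, 1}" using p by (auto simp: strip_boundary_def)
    have "(s, cis t) \<in> annulus_boundary"
      using st(2) by (simp add: annulus_boundary_def)
    then have "x (s, cis t) \<in> sphere 0 1"
      using bd unfolding legendrian_free_boundary_def legendrian_boundary_def by blast
    then show "norm (X p) = 1" by (simp add: X_def annulus_lift_def st)
    have "outward_conormal X p = X p"
      using bd p by (simp add: legendrian_free_boundary_def has_contact_angle_def X_def)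
    then show "\<exists>w. X p = diff1 X p w \<and> (if fst p = 1 then fst w > 0 else fst w < 0)"
      using outward_conormal_spec[OF X strip inj[OF strip]] by metis
  qed
  interpret holomorphic_annulus z w
  proof
    show "smooth_on strip z" "smooth_on strip w"
      unfolding z_def w_def
      by (rule smooth_on_strip_bounded_linear[OF bounded_linear_hk(1) X]
          smooth_on_strip_bounded_linear[OF bounded_linear_hk(2) X])+
    show "z (s, t + 2 * pi) = z (s, t)" "w (s, t + 2 * pi) = w (s, t)" for s t
      by (simp_all add: z_def w_def per)
    show "partial_s z p * partial_t w p = partial_t z p * partial_s w p" if "p \<in> strip" for p
      by (rule holo[OF that])
    show "Im (cnj (partial_s z p) * partial_t z p + cnj (partial_s w p) * partial_t w p) \<noteq> 0"
      if p: "p \<in> strip" for p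
    proof
      let ?a = "partial_s X p" and ?b = "partial_t X p"
      let ?K = "cnj (partial_s z p) * partial_t z p + cnj (partial_s w p) * partial_t w p"
      \<comment> \<open>Complex proportional vectors give equality in Cauchy-Schwarz for the
        hermitian product ?K. If ?K were real it would be the real inner product, and the Gram
        determinant would vanish.\<close>
      assume "Im ?K = 0"
      then have K: "?K = of_real (?a \<bullet> ?b)"
        using hk_inner[of \<gamma> ?a ?b] \<gamma> by (simp add: complex_eq_iff part[OF p])
      have "?K * cnj ?K = (cnj (partial_s z p) * partial_s z p + cnj (partial_s w p) * partial_s w p) *
          (cnj (partial_t z p) * partial_t z p + cnj (partial_t w p) * partial_t w p)"
        using holo[OF p] arg_cong[OF holo[OF p], of cnj] unfolding complex_cnj_mult complex_cnj_add complex_cnj_cnj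
        by algebra
      also have "\<dots> = of_real ((?a \<bullet> ?a) * (?b \<bullet> ?b))"
        unfolding part[OF p] hk_self by simp
      finally have "complex_of_real ((?a \<bullet> ?b)\<^sup>2) = of_real ((?a \<bullet> ?a) * (?b \<bullet> ?b))"
        unfolding K by (simp add: power2_eq_square)
      then have "(?a \<bullet> ?b)\<^sup>2 = (?a \<bullet> ?a) * (?b \<bullet> ?b)"
        using of_real_eq_iff by blast
      then show False using gram_pos(2)[OF X p inj[OF p]] by simp
    qed
  next
    fix s t :: real assume s: "s = 0 \<or> s = 1"
    then have p: "(s, t) \<in> strip_boundary" "(s, t) \<in> strip" by (auto simp: strip_boundary_def)
    show "cnj (z (s, t)) * z (s, t) + cnj (w (s, t)) * w (s, t) = 1"
      unfolding z_def w_def hk_self using point(1)[OF p(1)] by (simp add: norm_eq_1)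
    obtain a b where ab: "X (s, t) = diff1 X (s, t) (a, b)" "if s = 1 then a > 0 else a < 0"
      using point(2)[OF p(1)] by (metis fst_conv prod.collapse)
    have hk: "hk_z \<gamma> (a *\<^sub>R u + b *\<^sub>R v) = of_real a * hk_z \<gamma> u + of_real b * hk_z \<gamma> v"
      "hk_w \<gamma> (a *\<^sub>R u + b *\<^sub>R v) = of_real a * hk_w \<gamma> u + of_real b * hk_w \<gamma> v" for u v
      by (simp_all add: hk_z_def hk_w_def complex_eq_iff algebra_simps)
    have "X (s, t) = a *\<^sub>R partial_s X (s, t) + b *\<^sub>R partial_t X (s, t)"
      using ab(1) diff1_eq[OF X p(2), of "(a, b)"] by simp
    from arg_cong[OF this, of "hk_z \<gamma>"] arg_cong[OF this, of "hk_w \<gamma>"]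
    have "z (s, t) = of_real a * partial_s z (s, t) + of_real b * partial_t z (s, t) \<and>
        w (s, t) = of_real a * partial_s w (s, t) + of_real b * partial_t w (s, t)"
      unfolding part[OF p(2)] hk by (simp add: z_def w_def)
    with ab(2) show "\<exists>a b :: real. (if s = 1 then a > 0 else a < 0) \<and>
        z (s, t) = of_real a * partial_s z (s, t) + of_real b * partial_t z (s, t) \<and>
        w (s, t) = of_real a * partial_s w (s, t) + of_real b * partial_t w (s, t)"
      by blast
  qed
  show False by (rule no_free_boundary)
qed

end
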